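(* Let $\sigma\in(0,1]$ and suppose $c\in\{\pm\sigma\}^{\mathbf{N}}$ is pseudo-ergodic. If $\sigma=1$ then $\mathrm{Spec}(A_c^+)=S$. For all $\sigma\in(0,1]$, $\{\lambda\in\mathbf{C}:|\lambda|\le1\}\subset\mathrm{Spec}(A_c^+)$.
   Context: $\mathbf{N}$ denotes the positive integers. A sequence $c=(c_1,c_2,\dots)\in\{\pm\sigma\}^{\mathbf{N}}$ is pseudo-ergodic if it contains every finite sequence of $\pm\sigma$'s as a block of consecutive entries. $A_c^+$ is the bounded operator on $\ell^2(\mathbf{N})$ whose matrix is the semi-infinite tridiagonal matrix with zero diagonal, all superdiagonal entries $1$, and subdiagonal entries $(A_c^+)_{n+1,n}=c_n$, $n\ge1$. $S$ is defined as follows. For $b\in\{\pm1\}^{\mathbf{Z}}$ let $A_b$ be the bounded operator on $\ell^2(\mathbf{Z})$ given by $(A_bf)_n=b_nf_{n-1}+f_{n+1}$. A sequence $b\in\{\pm1\}^{\mathbf{Z}}$ is pseudo-ergodic if every finite sequence of $\pm1$'s occurs as a block of consecutive entries of $b$. It is known that $\mathrm{Spec}(A_b)$ is the same set for all pseudo-ergodic $b\in\{\pm1\}^{\mathbf{Z}}$; this common set is $S$. *)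

theory Defs
  imports "HOL-Analysis.Analysis"
begin

definition ell2 :: "('i \<Rightarrow> complex) set" where
  "ell2 = {f. (\<lambda>i. (cmod (f i))\<^sup>2) summable_on UNIV}"

definition ell2_norm :: "('i \<Rightarrow> complex) \<Rightarrow> real" where
  "ell2_norm f = sqrt (\<Sum>\<^sub>\<infinity>i. (cmod (f i))\<^sup>2)"

text \<open>Operators are total functions on sequences; only their restriction to \<open>ell2\<close> matters.\<close>

definition bounded_op :: "(('i \<Rightarrow> complex) \<Rightarrow> ('i \<Rightarrow> complex)) \<Rightarrow> bool" where
  "bounded_op T \<longleftrightarrow>
     (\<forall>f\<in>ell2. T f \<in> ell2) \<and>
     (\<forall>f\<in>ell2. \<forall>g\<in>ell2. T (\<lambda>i. f i + g i) = (\<lambda>i. T f i + T g i)) \<and>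
     (\<forall>a. \<forall>f\<in>ell2. T (\<lambda>i. a * f i) = (\<lambda>i. a * T f i)) \<and>
     (\<exists>K. \<forall>f\<in>ell2. ell2_norm (T f) \<le> K * ell2_norm f)"

definition Spec :: "(('i \<Rightarrow> complex) \<Rightarrow> ('i \<Rightarrow> complex)) \<Rightarrow> complex set" where
  "Spec T = {l. \<not> (\<exists>R. bounded_op R \<and>
     (\<forall>f\<in>ell2. R (\<lambda>i. T f i - l * f i) = f \<and> (\<lambda>i. T (R f) i - l * R f i) = f))}"

text \<open>The index type is \<open>nat\<close> or \<open>int\<close>.\<close>

definition pseudo_ergodic :: "real \<Rightarrow> ('i::semiring_1 \<Rightarrow> real) \<Rightarrow> bool" where
  "pseudo_ergodic \<sigma> c \<longleftrightarrow>
     (\<forall>w. set w \<subseteq> {\<sigma>, -\<sigma>} \<longrightarrow> (\<exists>n. \<forall>k<length w. c (n + of_nat k) = w ! k))"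

text \<open>Semi-infinite sequences and matrices are indexed from 0, so index \<open>n\<close> of type \<open>nat\<close>
  stands for the positive integer \<open>n + 1\<close>.\<close>

definition A_plus_matrix :: "(nat \<Rightarrow> real) \<Rightarrow> nat \<Rightarrow> nat \<Rightarrow> complex" where
  "A_plus_matrix c i j =
     (if j = i + 1 then 1 else if i = j + 1 then of_real (c j) else 0)"

definition A_plus :: "(nat \<Rightarrow> real) \<Rightarrow> (nat \<Rightarrow> complex) \<Rightarrow> nat \<Rightarrow> complex" where
  "A_plus c f = (\<lambda>i. \<Sum>\<^sub>\<infinity>j. A_plus_matrix c i j * f j)"

lemma A_plus_apply:
  "A_plus c f i = (if i = 0 then 0 else of_real (c (i - 1)) * f (i - 1)) + f (i + 1)"
proof -
  have "A_plus c f i = (\<Sum>\<^sub>\<infinity>j\<in>{i - 1, i + 1}. A_plus_matrix c i j * f j)"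
    unfolding A_plus_def
    by (rule infsum_cong_neutral) (auto simp: A_plus_matrix_def)
  then show ?thesis
    by (cases i) (auto simp: A_plus_matrix_def)
qed

definition A_bi :: "(int \<Rightarrow> real) \<Rightarrow> (int \<Rightarrow> complex) \<Rightarrow> int \<Rightarrow> complex" where
  "A_bi b f = (\<lambda>n. of_real (b n) * f (n - 1) + f (n + 1))"

text \<open>The operators \<open>A_bi b\<close> with \<open>b\<close> pseudo-ergodic all have the same spectrum (a known theorem,
  not proved here), so the description below is proper.\<close>

definition S :: "complex set" where
  "S = (THE X. \<forall>b. range b \<subseteq> {1, -1} \<and> pseudo_ergodic 1 b \<longrightarrow> Spec (A_bi b) = X)"

end

theory Submission imports Defs begin

text \<open>
  Call \<open>l\<close> an approximate eigenvalue of \<open>T\<close> if \<open>T - l\<close> is not bounded below on finitely supported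
  vectors. Approximate eigenvalues always lie in the spectrum
  (\<open>approx_spectrum_subset_Spec\<close>), and both claims are obtained by producing them.

  \<^bold>\<open>The case \<sigma> = 1.\<close> If all weights are signs, conjugation with a diagonal matrix of signs turns
  the matrix of \<open>A\<^sub>b\<close> or \<open>A\<^sub>c\<^sup>+\<close> into its transpose. Hence \<open>T - l\<close> is bounded below if and only
  if its adjoint is, and in this case it is invertible: for such operators every point of the
  spectrum is an approximate eigenvalue (\<open>Spec_eq_approx_spectrum_if_symmetric\<close>). A finitely
  supported approximate eigenvector sees finitely many weights only, and a pseudo-ergodic sequence
  contains each finite word. So the spectra of \<open>A\<^sub>b\<close> and of \<open>A\<^sub>c\<^sup>+\<close> contain every \<open>l\<close> that
  is approximated on the two-sided line by some choice of signs, depending on the accuracy. For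
  \<open>A\<^sub>b\<close> the converse is clear. For \<open>A\<^sub>c\<^sup>+\<close> an approximate eigenvector might live at the left
  end of the half-line; it is then glued to a reflected copy of itself with suitable signs, with
  the value zero at the mirror point, and the gluing creates no new error
  (\<open>reflection_to_bi_infinite\<close>). All these spectra therefore coincide, which shows at once that
  \<open>S\<close> is properly described and that it is the spectrum of \<open>A\<^sub>c\<^sup>+\<close>.

  \<^bold>\<open>The disc.\<close> Solve \<open>A\<^sub>c\<^sup>+ \<psi> = l \<psi>\<close> from the left end. If there is an infinite word
  \<open>\<beta>\<close> in \<open>\<plusminus>\<sigma>\<close> along which all solutions of the recurrence stay bounded, then, by
  pseudo-ergodicity, \<open>\<psi>\<close> meets a long prefix of \<open>\<beta>\<close> somewhere, and cutting \<open>\<psi>\<close> off linearly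
  along this prefix yields an approximate eigenvector
  (\<open>bounded_recurrence_imp_approx_spectrum\<close>); the part of \<open>\<psi>\<close> before the prefix satisfies the
  equation exactly and only adds to the norm.

  Such words come from a renormalisation. If \<open>\<beta>\<^bsub>2n+2\<^esub> = - \<beta>\<^bsub>2n+1\<^esub>\<close>, then the even entries of a
  solution for \<open>(\<beta>, l)\<close> solve the recurrence for \<open>(\<beta>', l\<^sup>2)\<close> with
  \<open>\<beta>'\<^sub>n = \<beta>\<^bsub>2n\<^esub> \<beta>\<^bsub>2n+1\<^esub>\<close>, and every \<open>\<beta>'\<close> arises in this way
  (\<open>bounded_recurrence_square_root\<close>). So boundedness passes from
  \<open>(\<sigma>\<^sup>2, l\<^sup>2)\<close> to \<open>(\<sigma>, l)\<close>. For \<open>\<sigma> < 1\<close> and \<open>0 < \<bar>l\<bar> < 1\<close>, repeated squaring leads to a pair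
  with \<open>\<bar>l\<bar> + \<sigma> \<le> 1\<close>, where boundedness is trivial. For \<open>\<sigma> = 1\<close> and \<open>l\<close> at a dyadic rational
  multiple of a full turn, it leads to a real \<open>l\<close> in \<open>(0, 1)\<close>, where a positive definite quadratic
  form is conserved. These \<open>l\<close> are dense in the disc, and the approximate eigenvalues form a closed
  set.
\<close>

section \<open>Square-summable families\<close>

lemma L2_set_power2: "(L2_set f F)\<^sup>2 = (\<Sum>i\<in>F. (f i)\<^sup>2)"
  by (simp add: L2_set_def sum_nonneg)

lemma ell2_norm_nonneg: "0 \<le> ell2_norm f"
  by (simp add: ell2_norm_def infsum_nonneg)

lemma ell2_norm_power2: "(ell2_norm f)\<^sup>2 = (\<Sum>\<^sub>\<infinity>i. (cmod (f i))\<^sup>2)"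
  by (simp add: ell2_norm_def infsum_nonneg)

lemma ell2_if_finite_sections_bounded:
  assumes "\<And>F. finite F \<Longrightarrow> L2_set (\<lambda>i. cmod (f i)) F \<le> M"
  shows "f \<in> ell2" "ell2_norm f \<le> M"
proof -
  have M: "0 \<le> M"
    using assms[of "{}"] by simp
  have fin: "(\<Sum>i\<in>F. (cmod (f i))\<^sup>2) \<le> M\<^sup>2" if "finite F" for F
    using power_mono[OF assms[OF that] L2_set_nonneg, of 2] by (simp add: L2_set_power2)
  have sm: "(\<lambda>i. (cmod (f i))\<^sup>2) summable_on UNIV"
    by (rule nonneg_bdd_above_summable_on) (auto simp: bdd_above_def intro!: exI[of _ "M\<^sup>2"] fin)
  then show "f \<in> ell2"
    by (simp add: ell2_def)
  have "(ell2_norm f)\<^sup>2 \<le> M\<^sup>2"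
    unfolding ell2_norm_power2 by (rule infsum_le_finite_sums[OF sm]) (use fin in auto)
  then show "ell2_norm f \<le> M"
    using M by (rule power2_le_imp_le)
qed

lemma L2_set_le_ell2_norm:
  assumes "f \<in> ell2" "finite F"
  shows "L2_set (\<lambda>i. cmod (f i)) F \<le> ell2_norm f"
proof (rule power2_le_imp_le[OF _ ell2_norm_nonneg])
  have "(\<Sum>i\<in>F. (cmod (f i))\<^sup>2) \<le> (\<Sum>\<^sub>\<infinity>i. (cmod (f i))\<^sup>2)"
    using assms by (intro finite_sum_le_infsum) (auto simp: ell2_def)
  then show "(L2_set (\<lambda>i. cmod (f i)) F)\<^sup>2 \<le> (ell2_norm f)\<^sup>2"
    by (simp add: L2_set_power2 ell2_norm_power2)
qed

lemma cmod_le_ell2_norm: "f \<in> ell2 \<Longrightarrow> cmod (f i) \<le> ell2_norm f"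
  using L2_set_le_ell2_norm[of f "{i}"] by (simp add: L2_set_def)

text \<open>All shifts, reflections and relabellings below, including those between \<open>nat\<close> and \<open>int\<close>,
  are compared through this one principle.\<close>

lemma
  fixes f :: "'i \<Rightarrow> complex" and g :: "'j \<Rightarrow> complex"
  assumes f: "f \<in> ell2" and inj: "inj_on h {i. g i \<noteq> 0}"
    and le: "\<And>i. g i \<noteq> 0 \<Longrightarrow> cmod (g i) \<le> cmod (f (h i))"
  shows ell2_if_dominated: "g \<in> ell2" and ell2_norm_le_if_dominated: "ell2_norm g \<le> ell2_norm f"
proof -
  have "L2_set (\<lambda>i. cmod (g i)) F \<le> ell2_norm f" if F: "finite F" for F
  proof -
    let ?G = "{i\<in>F. g i \<noteq> 0}"
    have "(\<Sum>i\<in>F. (cmod (g i))\<^sup>2) = (\<Sum>i\<in>?G. (cmod (g i))\<^sup>2)"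
      using F by (intro sum.mono_neutral_right) auto
    also have "\<dots> \<le> (\<Sum>i\<in>?G. (cmod (f (h i)))\<^sup>2)"
      using le by (intro sum_mono power_mono) auto
    also have "\<dots> = (\<Sum>i\<in>h ` ?G. (cmod (f i))\<^sup>2)"
      using inj by (subst sum.reindex) (auto simp: inj_on_def)
    finally have "L2_set (\<lambda>i. cmod (g i)) F \<le> L2_set (\<lambda>i. cmod (f i)) (h ` ?G)"
      by (simp add: L2_set_def)
    also have "\<dots> \<le> ell2_norm f"
      using F by (intro L2_set_le_ell2_norm f) auto
    finally show ?thesis .
  qed
  then show "g \<in> ell2" "ell2_norm g \<le> ell2_norm f"
    using ell2_if_finite_sections_bounded[of g] by blast+
qed

lemma ell2_norm_le_if_eq:
  fixes f :: "'i \<Rightarrow> complex" and g :: "'j \<Rightarrow> complex"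
  assumes "f \<in> ell2" "inj_on h {i. g i \<noteq> 0}" "\<And>i. g i \<noteq> 0 \<Longrightarrow> g i = f (h i)"
  shows "ell2_norm g \<le> ell2_norm f"
  using assms by (intro ell2_norm_le_if_dominated[of f h g]) auto

lemma
  assumes "f \<in> ell2" "g \<in> ell2"
  shows ell2_add: "(\<lambda>i. f i + g i) \<in> ell2"
    and ell2_norm_triangle: "ell2_norm (\<lambda>i. f i + g i) \<le> ell2_norm f + ell2_norm g"
proof -
  have "L2_set (\<lambda>i. cmod (f i + g i)) F \<le> ell2_norm f + ell2_norm g" if "finite F" for F
  proof -
    have "L2_set (\<lambda>i. cmod (f i + g i)) F \<le> L2_set (\<lambda>i. cmod (f i) + cmod (g i)) F"
      by (intro L2_set_mono) (auto intro: norm_triangle_ineq)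
    also have "\<dots> \<le> L2_set (\<lambda>i. cmod (f i)) F + L2_set (\<lambda>i. cmod (g i)) F"
      by (rule L2_set_triangle_ineq)
    also have "\<dots> \<le> ell2_norm f + ell2_norm g"
      by (intro add_mono L2_set_le_ell2_norm assms that)
    finally show ?thesis .
  qed
  then show "(\<lambda>i. f i + g i) \<in> ell2" "ell2_norm (\<lambda>i. f i + g i) \<le> ell2_norm f + ell2_norm g"
    using ell2_if_finite_sections_bounded[of "\<lambda>i. f i + g i"] by blast+
qed

lemma ell2_norm_scale: "ell2_norm (\<lambda>i. a * f i) = cmod a * ell2_norm f"
  by (simp add: ell2_norm_def norm_mult power_mult_distrib infsum_cmult_right' real_sqrt_mult)

lemma ell2_scale: "f \<in> ell2 \<Longrightarrow> (\<lambda>i. a * f i) \<in> ell2"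
  by (auto simp: ell2_def norm_mult power_mult_distrib intro!: summable_on_cmult_right)

lemma
  assumes "f \<in> ell2" "g \<in> ell2"
  shows ell2_diff: "(\<lambda>i. f i - g i) \<in> ell2"
    and ell2_norm_triangle_diff: "ell2_norm (\<lambda>i. f i - g i) \<le> ell2_norm f + ell2_norm g"
  using ell2_add[OF assms(1) ell2_scale[OF assms(2), of "-1"]]
    ell2_norm_triangle[OF assms(1) ell2_scale[OF assms(2), of "-1"]]
    ell2_norm_scale[of "-1" g] by simp_all

lemma ell2_zero: "(\<lambda>i. 0) \<in> ell2"
  by (simp add: ell2_def)

lemma ell2_norm_eq_0D:
  assumes "f \<in> ell2" "ell2_norm f = 0"
  shows "f = (\<lambda>i. 0)"
proof
  show "f i = 0" for i
    using cmod_le_ell2_norm[OF assms(1), of i] assms(2) by simp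
qed

lemma ell2_finite_support:
  assumes "finite {i. f i \<noteq> 0}"
  shows "f \<in> ell2"
proof -
  have "(\<lambda>i. (cmod (f i))\<^sup>2) summable_on {i. f i \<noteq> 0}"
    using assms by simp
  then have "(\<lambda>i. (cmod (f i))\<^sup>2) summable_on UNIV"
    by (rule summable_on_cong_neutral[THEN iffD1, rotated -1]) auto
  then show ?thesis
    by (simp add: ell2_def)
qed

lemma ell2_norm_truncation:
  assumes f: "f \<in> ell2" and e: "0 < e"
  obtains F where "finite F" "ell2_norm (\<lambda>i. f i - (if i \<in> F then f i else 0)) \<le> e"
proof -
  have sm: "(\<lambda>i. (cmod (f i))\<^sup>2) summable_on UNIV"
    using f by (simp add: ell2_def)
  obtain F where F: "finite F"
    and d: "dist (\<Sum>i\<in>F. (cmod (f i))\<^sup>2) (\<Sum>\<^sub>\<infinity>i. (cmod (f i))\<^sup>2) \<le> e\<^sup>2"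
    using infsum_finite_approximation[OF sm, of "e\<^sup>2"] e by auto
  let ?g = "\<lambda>i. f i - (if i \<in> F then f i else 0)"
  have "L2_set (\<lambda>i. cmod (?g i)) G \<le> e" if G: "finite G" for G
  proof (rule power2_le_imp_le)
    have "(\<Sum>i\<in>G. (cmod (?g i))\<^sup>2) = (\<Sum>i\<in>G - F. (cmod (f i))\<^sup>2)"
      using G by (intro sum.mono_neutral_cong_right) auto
    also have "\<dots> = (\<Sum>i\<in>G \<union> F. (cmod (f i))\<^sup>2) - (\<Sum>i\<in>F. (cmod (f i))\<^sup>2)"
      using G F by (subst sum_diff[symmetric]) (auto intro: sum.cong)
    also have "\<dots> \<le> (\<Sum>\<^sub>\<infinity>i. (cmod (f i))\<^sup>2) - (\<Sum>i\<in>F. (cmod (f i))\<^sup>2)"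
      using G F sm by (intro diff_right_mono finite_sum_le_infsum) auto
    also have "\<dots> \<le> e\<^sup>2"
      using d by (simp add: dist_real_def)
    finally show "(L2_set (\<lambda>i. cmod (?g i)) G)\<^sup>2 \<le> e\<^sup>2"
      by (simp add: L2_set_power2)
  qed (use e in auto)
  then have "ell2_norm ?g \<le> e"
    by (rule ell2_if_finite_sections_bounded)
  with F show thesis
    using that by blast
qed

lemma ell2_cnj:
  assumes "f \<in> ell2"
  shows "(\<lambda>i. cnj (f i)) \<in> ell2"
  using assms by (simp add: ell2_def)

lemma
  assumes "f \<in> ell2" "g \<in> ell2"
  shows Re_inner_summable: "(\<lambda>i. Re (f i * cnj (g i))) summable_on UNIV"
    and ell2_norm_diff_power2: "(ell2_norm (\<lambda>i. f i - of_real t * g i))\<^sup>2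
      = (ell2_norm f)\<^sup>2 - 2 * t * (\<Sum>\<^sub>\<infinity>i. Re (f i * cnj (g i))) + t\<^sup>2 * (ell2_norm g)\<^sup>2"
proof -
  have f: "(\<lambda>i. (cmod (f i))\<^sup>2) summable_on UNIV" and g: "(\<lambda>i. (cmod (g i))\<^sup>2) summable_on UNIV"
    and fg: "(\<lambda>i. (cmod (f i + g i))\<^sup>2) summable_on UNIV"
    using assms ell2_add[OF assms] by (auto simp: ell2_def)
  have polar: "(cmod (z - of_real t * w))\<^sup>2 = (cmod z)\<^sup>2 + (-2 * t) * Re (z * cnj w) + t\<^sup>2 * (cmod w)\<^sup>2"
    for z w :: complex and t
    unfolding cmod_power2 by (simp add: power2_eq_square algebra_simps)
  have "(\<lambda>i. (1/2) * ((cmod (f i + g i))\<^sup>2 + (-1) * (cmod (f i))\<^sup>2 + (-1) * (cmod (g i))\<^sup>2))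
      summable_on UNIV"
    by (intro summable_on_cmult_right summable_on_add f g fg)
  also have "(\<lambda>i. (1/2) * ((cmod (f i + g i))\<^sup>2 + (-1) * (cmod (f i))\<^sup>2 + (-1) * (cmod (g i))\<^sup>2))
      = (\<lambda>i. Re (f i * cnj (g i)))"
    using polar[of _ "-1"] by (auto simp: fun_eq_iff)
  finally show sm: "(\<lambda>i. Re (f i * cnj (g i))) summable_on UNIV" .
  show "(ell2_norm (\<lambda>i. f i - of_real t * g i))\<^sup>2
      = (ell2_norm f)\<^sup>2 - 2 * t * (\<Sum>\<^sub>\<infinity>i. Re (f i * cnj (g i))) + t\<^sup>2 * (ell2_norm g)\<^sup>2"
  proof -
    have "(\<Sum>\<^sub>\<infinity>i. (cmod (f i))\<^sup>2 + (-2 * t) * Re (f i * cnj (g i)) + t\<^sup>2 * (cmod (g i))\<^sup>2)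
        = (\<Sum>\<^sub>\<infinity>i. (cmod (f i))\<^sup>2) + (\<Sum>\<^sub>\<infinity>i. (-2 * t) * Re (f i * cnj (g i)))
          + (\<Sum>\<^sub>\<infinity>i. t\<^sup>2 * (cmod (g i))\<^sup>2)"
      by (simp only: infsum_add summable_on_add summable_on_cmult_right f g sm)
    then show ?thesis
      unfolding ell2_norm_power2 polar by (simp only: infsum_cmult_right')
  qed
qed

lemma Re_prod_summable:
  assumes "f \<in> ell2" "g \<in> ell2"
  shows "(\<lambda>i. Re (f i * g i)) summable_on UNIV"
  using Re_inner_summable[OF assms(1) ell2_cnj[OF assms(2)]] by simp


section \<open>Operators with a symmetric matrix up to signs\<close>

text \<open>Linearity is asked for on all families and not only on \<open>ell2\<close>; together with the
  continuity under entrywise convergence, which every matrix with finitely supported rows has,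
  it lets Neumann series be summed entry by entry, without completeness of \<open>ell2\<close>.\<close>

locale ell2_operator =
  fixes T :: "('i \<Rightarrow> complex) \<Rightarrow> ('i \<Rightarrow> complex)" and C :: real
  assumes add: "T (\<lambda>i. f i + g i) = (\<lambda>i. T f i + T g i)"
    and scale: "T (\<lambda>i. a * f i) = (\<lambda>i. a * T f i)"
    and mem: "f \<in> ell2 \<Longrightarrow> T f \<in> ell2"
    and bound: "f \<in> ell2 \<Longrightarrow> ell2_norm (T f) \<le> C * ell2_norm f"
    and cont: "(\<And>j. (\<lambda>n. F n j) \<longlonglongrightarrow> h j) \<Longrightarrow> (\<lambda>n. T (F n) i) \<longlonglongrightarrow> T h i"
begin

lemma diff: "T (\<lambda>i. f i - g i) = (\<lambda>i. T f i - T g i)"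
  using add[of f "\<lambda>i. (-1) * g i"] scale[of "-1" g] by simp

lemma shifted: "ell2_operator (\<lambda>f i. T f i - l * f i) (C + cmod l)"
proof
  fix f :: "'i \<Rightarrow> complex" assume f: "f \<in> ell2"
  show "(\<lambda>i. T f i - l * f i) \<in> ell2"
    by (intro ell2_diff mem ell2_scale f)
  have "ell2_norm (\<lambda>i. T f i - l * f i) \<le> ell2_norm (T f) + ell2_norm (\<lambda>i. l * f i)"
    by (intro ell2_norm_triangle_diff mem ell2_scale f)
  then show "ell2_norm (\<lambda>i. T f i - l * f i) \<le> (C + cmod l) * ell2_norm f"
    using bound[OF f] by (simp add: ell2_norm_scale algebra_simps)
next
  fix F :: "nat \<Rightarrow> 'i \<Rightarrow> complex" and h i assume "\<And>j. (\<lambda>n. F n j) \<longlonglongrightarrow> h j"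
  then show "(\<lambda>n. T (F n) i - l * F n i) \<longlonglongrightarrow> T h i - l * h i"
    by (intro tendsto_diff cont tendsto_mult tendsto_const)
qed (simp_all add: add scale algebra_simps)

end

text \<open>The partial sums of \<open>\<Sum>k. B\<^sup>k f\<close> converge in each entry because an entry is at most the norm,
  and the limit is square-summable because the norms of its finite sections are at most the sum of a
  geometric series.\<close>

lemma neumann_series:
  fixes B :: "('i \<Rightarrow> complex) \<Rightarrow> ('i \<Rightarrow> complex)"
  assumes q: "0 \<le> q" "q < 1"
    and diff: "\<And>f g. B (\<lambda>i. f i - g i) = (\<lambda>i. B f i - B g i)"
    and mem: "\<And>f. f \<in> ell2 \<Longrightarrow> B f \<in> ell2"
    and contraction: "\<And>f. f \<in> ell2 \<Longrightarrow> ell2_norm (B f) \<le> q * ell2_norm f"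
    and cont: "\<And>F h i. (\<And>j. (\<lambda>n. F n j) \<longlonglongrightarrow> h j) \<Longrightarrow> (\<lambda>n. B (F n) i) \<longlonglongrightarrow> B h i"
    and f: "f \<in> ell2"
  obtains z where "z \<in> ell2" "\<And>i. z i - B z i = f i"
proof -
  define p where "p n = (B ^^ n) f" for n
  have p_Suc: "p (Suc n) = B (p n)" for n
    by (simp add: p_def)
  have p: "p n \<in> ell2 \<and> ell2_norm (p n) \<le> q ^ n * ell2_norm f" for n
  proof (induction n)
    case (Suc n)
    have "ell2_norm (B (p n)) \<le> q * (q ^ n * ell2_norm f)"
      using Suc contraction[of "p n"] q by (meson mult_left_mono order_trans)
    with Suc show ?case
      by (simp add: p_Suc mem mult.assoc)
  qed (use f in \<open>simp add: p_def\<close>)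
  have geo: "summable (\<lambda>n. q ^ n * ell2_norm f)"
    using q by (intro summable_mult2 summable_geometric) simp
  have pt: "cmod (p n i) \<le> q ^ n * ell2_norm f" for n i
    using cmod_le_ell2_norm[of "p n" i] p[of n] by simp
  have p_sums: "summable (\<lambda>n. p n i)" for i
    by (rule summable_comparison_test'[OF geo, of 0]) (use pt in auto)
  have p_tendsto: "(\<lambda>n. p n i) \<longlonglongrightarrow> 0" for i
    by (rule summable_LIMSEQ_zero[OF p_sums])
  define s where "s n i = (\<Sum>k<n. p k i)" for n i
  define z where "z i = (\<Sum>k. p k i)" for i
  have s_z: "(\<lambda>n. s n i) \<longlonglongrightarrow> z i" for i
    unfolding s_def z_def using p_sums by (rule summable_LIMSEQ)
  have B_zero: "B (\<lambda>i. 0) = (\<lambda>i. 0)"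
    using diff[of "\<lambda>i. 0" "\<lambda>i. 0"] by simp
  have B_add: "B (\<lambda>i. g i + h i) = (\<lambda>i. B g i + B h i)" for g h
    using diff[of g "\<lambda>i. 0 - h i"] diff[of "\<lambda>i. 0" h] by (simp add: B_zero)
  have s_B: "s n i - B (s n) i = f i - p n i" for n i
  proof (induction n)
    case 0
    show ?case by (simp add: s_def[abs_def] B_zero) (simp add: p_def)
  next
    case (Suc n)
    have "s (Suc n) = (\<lambda>i. s n i + p n i)"
      by (simp add: s_def fun_eq_iff)
    then show ?case
      using Suc by (simp add: B_add p_Suc algebra_simps)
  qed
  have "z i - B z i = f i" for i
  proof (rule LIMSEQ_unique)
    show "(\<lambda>n. s n i - B (s n) i) \<longlonglongrightarrow> z i - B z i"
      by (intro tendsto_diff s_z cont)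
    have "(\<lambda>n. f i - p n i) \<longlonglongrightarrow> f i - 0"
      by (intro tendsto_diff tendsto_const p_tendsto)
    then show "(\<lambda>n. s n i - B (s n) i) \<longlonglongrightarrow> f i"
      by (simp add: s_B)
  qed
  moreover have "z \<in> ell2"
  proof (rule ell2_if_finite_sections_bounded)
    fix F :: "'i set" assume F: "finite F"
    have s: "s n \<in> ell2 \<and> ell2_norm (s n) \<le> (\<Sum>k<n. q ^ k * ell2_norm f)" for n
    proof (induction n)
      case 0
      show ?case
        by (simp add: s_def[abs_def] ell2_zero) (simp add: ell2_norm_def)
    next
      case (Suc n)
      have "s (Suc n) = (\<lambda>i. s n i + p n i)"
        by (simp add: s_def fun_eq_iff)
      then show ?case
        using Suc p[of n] ell2_norm_triangle[of "s n" "p n"] by (auto intro: ell2_add)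
    qed
    have "L2_set (\<lambda>i. cmod (s n i)) F \<le> (\<Sum>k. q ^ k * ell2_norm f)" for n
    proof -
      have "L2_set (\<lambda>i. cmod (s n i)) F \<le> ell2_norm (s n)"
        using s F by (intro L2_set_le_ell2_norm) auto
      also have "\<dots> \<le> (\<Sum>k<n. q ^ k * ell2_norm f)"
        using s by simp
      also have "\<dots> \<le> (\<Sum>k. q ^ k * ell2_norm f)"
        using q by (intro sum_le_suminf geo) (auto simp: ell2_norm_nonneg)
      finally show ?thesis .
    qed
    moreover have "(\<lambda>n. L2_set (\<lambda>i. cmod (s n i)) F) \<longlonglongrightarrow> L2_set (\<lambda>i. cmod (z i)) F"
      unfolding L2_set_def by (intro tendsto_intros s_z)
    ultimately show "L2_set (\<lambda>i. cmod (z i)) F \<le> (\<Sum>k. q ^ k * ell2_norm f)"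
      by (intro LIMSEQ_le_const2) auto
  qed
  ultimately show thesis
    using that by blast
qed

text \<open>Symmetry of \<open>\<Sum>i. d\<^sub>i f\<^sub>i (T g)\<^sub>i\<close> makes \<open>T\<close> unitarily equivalent to the complex
  conjugate of its adjoint \<open>V\<close>, so \<open>V\<close> inherits the lower bound \<open>\<nu>\<close>. For \<open>K\<close> above the norm of
  \<open>T\<close> this gives
  \<open>\<parallel>x - T V x / K\<^sup>2\<parallel>\<^sup>2 \<le> \<parallel>x\<parallel>\<^sup>2 - \<parallel>V x\<parallel>\<^sup>2 / K\<^sup>2 \<le> (1 - \<nu>\<^sup>2 / K\<^sup>2) \<parallel>x\<parallel>\<^sup>2\<close>.
  So \<open>T V\<close> is inverted by a Neumann series, and \<open>T\<close> is onto.\<close>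

lemma (in ell2_operator) surjective_if_symmetric:
  fixes d :: "'i \<Rightarrow> real"
  assumes d: "\<And>i. d i = 1 \<or> d i = -1"
    and sym: "\<And>f g. f \<in> ell2 \<Longrightarrow> g \<in> ell2 \<Longrightarrow>
      (\<Sum>\<^sub>\<infinity>i. Re (d i * (f i * T g i))) = (\<Sum>\<^sub>\<infinity>i. Re (d i * (g i * T f i)))"
    and \<nu>: "0 < \<nu>" and below: "\<And>f. f \<in> ell2 \<Longrightarrow> \<nu> * ell2_norm f \<le> ell2_norm (T f)"
    and f: "f \<in> ell2"
  obtains x where "x \<in> ell2" "T x = f"
proof -
  define U where "U g i = d i * cnj (g i)" for g :: "'i \<Rightarrow> complex" and i
  define V where "V g = U (T (U g))" for g
  define K where "K = max (max C \<nu>) 1"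
  have K: "\<nu> \<le> K" "C \<le> K" "0 < K"
    by (auto simp: K_def)
  have d2: "complex_of_real (d i) * complex_of_real (d i) = 1" "\<bar>d i\<bar> = 1" for i
    using d[of i] by auto
  have cmod_U: "cmod (U g i) = cmod (g i)" for g i
    by (simp add: U_def norm_mult d2)
  have U: "U g \<in> ell2 \<longleftrightarrow> g \<in> ell2" "ell2_norm (U g) = ell2_norm g" for g
    by (simp_all add: ell2_def ell2_norm_def cmod_U)
  have U_diff: "U (\<lambda>i. g i - h i) = (\<lambda>i. U g i - U h i)" for g h
    by (simp add: U_def fun_eq_iff algebra_simps)
  have V_mem: "V g \<in> ell2" if "g \<in> ell2" for g
    using that by (simp add: V_def U mem)
  have V_diff: "V (\<lambda>i. g i - h i) = (\<lambda>i. V g i - V h i)" for g h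
    by (simp add: V_def U_diff diff)
  have V_scale: "V (\<lambda>i. of_real r * g i) = (\<lambda>i. of_real r * V g i)" for r g
  proof -
    have "U (\<lambda>i. of_real r * g i) = (\<lambda>i. of_real r * U g i)" for g
      by (simp add: U_def fun_eq_iff)
    then show ?thesis
      by (simp add: V_def scale)
  qed
  have V_cont: "(\<lambda>n. V (F n) i) \<longlonglongrightarrow> V h i" if "\<And>j. (\<lambda>n. F n j) \<longlonglongrightarrow> h j" for F h i
  proof -
    have "(\<lambda>n. T (U (F n)) j) \<longlonglongrightarrow> T (U h) j" for j
      by (rule cont) (unfold U_def, intro tendsto_intros that)
    then show ?thesis
      unfolding V_def by (subst (1 2) U_def) (intro tendsto_intros)
  qed
  \<comment> \<open>The left-hand side is the real inner product of \<open>x\<close> with \<open>T (V x)\<close>: this is where \<open>V\<close> is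
    recognised as the adjoint of \<open>T\<close>.\<close>
  have adjoint: "(\<Sum>\<^sub>\<infinity>i. Re (x i * cnj (T (V x) i))) = (ell2_norm (V x))\<^sup>2" if x: "x \<in> ell2" for x
  proof -
    have "Re (d i * (U x i * T (V x) i)) = Re (x i * cnj (T (V x) i))" for i
      using d[of i] by (auto simp: U_def)
    moreover have "Re (d i * (V x i * T (U x) i)) = (cmod (V x i))\<^sup>2" for i
    proof -
      have "V x i = d i * cnj (T (U x) i)"
        by (simp add: V_def U_def)
      then show ?thesis
        using d[of i] by (auto simp: cmod_power2) (simp_all add: power2_eq_square)
    qed
    ultimately show ?thesis
      using sym[of "U x" "V x"] x by (simp add: U V_mem ell2_norm_power2)
  qed
  define t where "t = 1 / K\<^sup>2"
  define B where "B x i = x i - of_real t * T (V x) i" for x i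
  define q where "q = sqrt (1 - \<nu>\<^sup>2 / K\<^sup>2)"
  have nuK: "\<nu>\<^sup>2 / K\<^sup>2 \<le> 1" "0 < \<nu>\<^sup>2 / K\<^sup>2"
    using K \<nu> by (auto simp: power_mono)
  have q: "0 \<le> q" "q < 1" "q\<^sup>2 = 1 - \<nu>\<^sup>2 / K\<^sup>2"
    using nuK by (auto simp: q_def)
  have contraction: "ell2_norm (B x) \<le> q * ell2_norm x" if x: "x \<in> ell2" for x
  proof (rule power2_le_imp_le)
    have TV: "(ell2_norm (T (V x)))\<^sup>2 \<le> K\<^sup>2 * (ell2_norm (V x))\<^sup>2"
    proof -
      have "ell2_norm (T (V x)) \<le> K * ell2_norm (V x)"
        using bound[OF V_mem[OF x]] mult_right_mono[OF K(2) ell2_norm_nonneg[of "V x"]] by linarith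
      from power_mono[OF this ell2_norm_nonneg, of 2] show ?thesis
        by (simp add: power_mult_distrib)
    qed
    have V_below: "\<nu>\<^sup>2 * (ell2_norm x)\<^sup>2 \<le> (ell2_norm (V x))\<^sup>2"
    proof -
      have "\<nu> * ell2_norm x \<le> ell2_norm (V x)"
        using below[of "U x"] x by (simp add: V_def U)
      from power_mono[OF this, of 2] show ?thesis
        using \<nu> by (simp add: power_mult_distrib ell2_norm_nonneg)
    qed
    have "(ell2_norm (B x))\<^sup>2
        = (ell2_norm x)\<^sup>2 - 2 * t * (ell2_norm (V x))\<^sup>2 + t\<^sup>2 * (ell2_norm (T (V x)))\<^sup>2"
      unfolding B_def
      by (subst ell2_norm_diff_power2) (simp_all only: x mem V_mem adjoint)
    also have "\<dots> \<le> (ell2_norm x)\<^sup>2 - 2 * t * (ell2_norm (V x))\<^sup>2 + t\<^sup>2 * (K\<^sup>2 * (ell2_norm (V x))\<^sup>2)"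
      using TV by (intro add_left_mono mult_left_mono) auto
    also have "\<dots> = (ell2_norm x)\<^sup>2 - t * (ell2_norm (V x))\<^sup>2"
      using K by (simp add: t_def field_simps power2_eq_square)
    also have "\<dots> \<le> (ell2_norm x)\<^sup>2 - t * (\<nu>\<^sup>2 * (ell2_norm x)\<^sup>2)"
      using V_below by (intro diff_left_mono mult_left_mono) (auto simp: t_def)
    also have "\<dots> = (q * ell2_norm x)\<^sup>2"
      by (simp add: power_mult_distrib q t_def field_simps)
    finally show "(ell2_norm (B x))\<^sup>2 \<le> (q * ell2_norm x)\<^sup>2" .
  qed (simp add: q ell2_norm_nonneg)
  have B_mem: "B x \<in> ell2" if "x \<in> ell2" for x
    unfolding B_def by (intro ell2_diff ell2_scale mem V_mem that)
  have B_cont: "(\<lambda>n. B (F n) i) \<longlonglongrightarrow> B h i" if "\<And>j. (\<lambda>n. F n j) \<longlonglongrightarrow> h j" for F h i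
    unfolding B_def by (intro tendsto_intros that cont V_cont)
  have B_diff: "B (\<lambda>i. g i - h i) = (\<lambda>i. B g i - B h i)" for g h
    by (simp add: B_def V_diff diff fun_eq_iff algebra_simps)
  obtain z where z: "z \<in> ell2" "\<And>i. z i - B z i = f i"
    using neumann_series[OF q(1,2) B_diff B_mem contraction B_cont f] by blast
  have "T (V (\<lambda>i. of_real t * z i)) = f"
    using z(2) by (simp add: V_scale scale fun_eq_iff B_def)
  moreover have "V (\<lambda>i. of_real t * z i) \<in> ell2"
    by (intro V_mem ell2_scale z)
  ultimately show thesis
    using that by blast
qed

section \<open>Approximate eigenvectors\<close>

definition approx_spectrum :: "(('i \<Rightarrow> complex) \<Rightarrow> ('i \<Rightarrow> complex)) \<Rightarrow> complex set" where
  "approx_spectrum T = {l. \<forall>e>0. \<exists>f. finite {i. f i \<noteq> 0} \<and>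
     ell2_norm (\<lambda>i. T f i - l * f i) < e * ell2_norm f}"

lemma (in ell2_operator) approx_spectrum_subset_Spec: "approx_spectrum T \<subseteq> Spec T"
proof
  fix l assume l: "l \<in> approx_spectrum T"
  interpret Tl: ell2_operator "\<lambda>f i. T f i - l * f i" "C + cmod l"
    by (rule shifted)
  show "l \<in> Spec T"
  proof (rule ccontr)
    assume "l \<notin> Spec T"
    then obtain R where R: "bounded_op R" "\<And>f. f \<in> ell2 \<Longrightarrow> R (\<lambda>i. T f i - l * f i) = f"
      unfolding Spec_def by blast
    then obtain K where K: "\<And>f. f \<in> ell2 \<Longrightarrow> ell2_norm (R f) \<le> K * ell2_norm f"
      unfolding bounded_op_def by blast
    define e where "e = 1 / (\<bar>K\<bar> + 1)"
    have "e > 0"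
      by (simp add: e_def)
    with l obtain f where fin: "finite {i. f i \<noteq> 0}"
      and f: "ell2_norm (\<lambda>i. T f i - l * f i) < e * ell2_norm f"
      unfolding approx_spectrum_def by blast
    let ?g = "\<lambda>i. T f i - l * f i"
    have fl: "f \<in> ell2"
      using fin by (rule ell2_finite_support)
    have "ell2_norm f \<le> K * ell2_norm ?g"
      using K[OF Tl.mem[OF fl]] R(2)[OF fl] by simp
    also have "\<dots> \<le> (\<bar>K\<bar> + 1) * ell2_norm ?g"
      by (intro mult_right_mono ell2_norm_nonneg) simp
    also have "\<dots> < (\<bar>K\<bar> + 1) * (e * ell2_norm f)"
      using f by (intro mult_strict_left_mono) auto
    also have "\<dots> = ell2_norm f"
      by (simp add: e_def)
    finally show False by simp
  qed
qed

text \<open>An approximate eigenvector for \<open>m\<close> serves for \<open>l\<close> too, with an additional error \<open>\<bar>m - l\<bar>\<close>.\<close>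

lemma (in ell2_operator) approx_spectrum_closed:
  assumes "\<And>e. 0 < e \<Longrightarrow> \<exists>m\<in>approx_spectrum T. cmod (m - l) < e"
  shows "l \<in> approx_spectrum T"
  unfolding approx_spectrum_def mem_Collect_eq
proof (intro allI impI)
  fix e :: real assume e: "0 < e"
  then obtain m where m: "m \<in> approx_spectrum T" "cmod (m - l) < e / 2"
    using assms[of "e / 2"] by auto
  then obtain f where fin: "finite {i. f i \<noteq> 0}"
    and f: "ell2_norm (\<lambda>i. T f i - m * f i) < e / 2 * ell2_norm f"
    using e half_gt_zero[OF e] unfolding approx_spectrum_def by blast
  have fl: "f \<in> ell2"
    using fin by (rule ell2_finite_support)
  have "ell2_norm (\<lambda>i. (T f i - m * f i) + (m - l) * f i)
      \<le> ell2_norm (\<lambda>i. T f i - m * f i) + cmod (m - l) * ell2_norm f"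
    unfolding ell2_norm_scale[symmetric]
    by (intro ell2_norm_triangle ell2_diff ell2_scale mem fl)
  also have "\<dots> < e / 2 * ell2_norm f + e / 2 * ell2_norm f"
    using f m(2) by (intro add_less_le_mono mult_right_mono) (auto simp: ell2_norm_nonneg)
  finally have "ell2_norm (\<lambda>i. T f i - l * f i) < e * ell2_norm f"
    by (simp add: algebra_simps)
  with fin show "\<exists>f. finite {i. f i \<noteq> 0} \<and> ell2_norm (\<lambda>i. T f i - l * f i) < e * ell2_norm f"
    by blast
qed

text \<open>By definition the bound holds on finitely supported vectors; these are dense and \<open>T - l\<close> is
  continuous.\<close>

lemma (in ell2_operator) bounded_below_if_not_approx_spectrum:
  assumes "l \<notin> approx_spectrum T"
  obtains \<nu> where "0 < \<nu>" "\<And>f. f \<in> ell2 \<Longrightarrow> \<nu> * ell2_norm f \<le> ell2_norm (\<lambda>i. T f i - l * f i)"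
proof -
  interpret Tl: ell2_operator "\<lambda>f i. T f i - l * f i" "C + cmod l"
    by (rule shifted)
  let ?Tl = "\<lambda>f i. T f i - l * f i"
  define K where "K = max (C + cmod l) 0"
  have K: "ell2_norm (?Tl f) \<le> K * ell2_norm f" if "f \<in> ell2" for f
    using Tl.bound[OF that] mult_right_mono[of "C + cmod l" K "ell2_norm f"]
    by (simp add: K_def ell2_norm_nonneg)
  have K0: "0 \<le> K"
    by (simp add: K_def)
  obtain \<nu> where \<nu>: "0 < \<nu>"
    and fin: "\<And>f. finite {i. f i \<noteq> 0} \<Longrightarrow> \<nu> * ell2_norm f \<le> ell2_norm (?Tl f)"
    using assms unfolding approx_spectrum_def by (auto simp: not_less)
  have "\<nu> * ell2_norm f \<le> ell2_norm (?Tl f)" if f: "f \<in> ell2" for f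
  proof (rule field_le_epsilon)
    fix e :: real assume e: "0 < e"
    define r where "r = e / (\<nu> + K)"
    have r: "0 < r" "(\<nu> + K) * r = e"
      using \<nu> K0 e by (auto simp: r_def)
    obtain F where F: "finite F" "ell2_norm (\<lambda>i. f i - (if i \<in> F then f i else 0)) \<le> r"
      using ell2_norm_truncation[OF f r(1)] .
    define g where "g i = (if i \<in> F then f i else 0)" for i
    define h where "h i = f i - g i" for i
    have "finite {i. g i \<noteq> 0}"
      by (rule finite_subset[OF _ F(1)]) (auto simp: g_def)
    then have g: "g \<in> ell2" "\<nu> * ell2_norm g \<le> ell2_norm (?Tl g)"
      by (auto intro: ell2_finite_support fin)
    have h: "h \<in> ell2" "ell2_norm h \<le> r"
      using F(2) ell2_diff[OF f g(1)] by (auto simp: h_def[abs_def] g_def[abs_def])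
    have "ell2_norm f \<le> ell2_norm g + ell2_norm h"
      using ell2_norm_triangle[OF g(1) h(1)] by (simp add: h_def)
    then have "\<nu> * ell2_norm f \<le> \<nu> * ell2_norm g + \<nu> * r"
      using \<nu> h(2) by (metis add_left_mono distrib_left less_imp_le mult_left_mono order_trans)
    moreover have "ell2_norm (?Tl g) \<le> ell2_norm (?Tl f) + K * r"
    proof -
      have "?Tl g = (\<lambda>i. ?Tl f i - ?Tl h i)"
        unfolding Tl.diff[symmetric] by (simp add: h_def)
      then have "ell2_norm (?Tl g) \<le> ell2_norm (?Tl f) + ell2_norm (?Tl h)"
        using ell2_norm_triangle_diff[OF Tl.mem[OF f] Tl.mem[OF h(1)]] by simp
      moreover have "ell2_norm (?Tl h) \<le> K * r"
        using K[OF h(1)] mult_left_mono[OF h(2) K0] by linarith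
      ultimately show ?thesis by linarith
    qed
    ultimately have "\<nu> * ell2_norm f \<le> ell2_norm (?Tl f) + (\<nu> + K) * r"
      using g(2) by (simp add: algebra_simps)
    then show "\<nu> * ell2_norm f \<le> ell2_norm (?Tl f) + e"
      by (simp add: r)
  qed
  with \<nu> show thesis
    using that by blast
qed

text \<open>Subtracting \<open>l\<close> preserves the symmetry, so off the approximate eigenvalues \<open>T - l\<close> is onto and
  bounded below, and its inverse is bounded.\<close>

lemma (in ell2_operator) Spec_eq_approx_spectrum_if_symmetric:
  fixes d :: "'i \<Rightarrow> real"
  assumes d: "\<And>i. d i = 1 \<or> d i = -1"
    and sym: "\<And>f g. f \<in> ell2 \<Longrightarrow> g \<in> ell2 \<Longrightarrow>
      (\<Sum>\<^sub>\<infinity>i. Re (d i * (f i * T g i))) = (\<Sum>\<^sub>\<infinity>i. Re (d i * (g i * T f i)))"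
  shows "Spec T = approx_spectrum T"
proof (intro equalityI approx_spectrum_subset_Spec subsetI)
  fix l assume "l \<in> Spec T"
  show "l \<in> approx_spectrum T"
  proof (rule ccontr)
    assume "l \<notin> approx_spectrum T"
    then obtain \<nu> where \<nu>: "0 < \<nu>"
      and below: "\<And>f. f \<in> ell2 \<Longrightarrow> \<nu> * ell2_norm f \<le> ell2_norm (\<lambda>i. T f i - l * f i)"
      using bounded_below_if_not_approx_spectrum by blast
    let ?Tl = "\<lambda>f i. T f i - l * f i"
    interpret Tl: ell2_operator ?Tl "C + cmod l"
      by (rule shifted)
    have d_abs: "\<bar>d i\<bar> = 1" for i
      using d[of i] by auto
    have summable: "(\<lambda>i. Re (d i * (f i * g i))) summable_on UNIV" if "f \<in> ell2" "g \<in> ell2"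
      for f g :: "'i \<Rightarrow> complex"
    proof -
      have "(\<lambda>i. d i * f i) \<in> ell2"
        by (rule ell2_if_dominated[OF that(1), where h = id]) (auto simp: norm_mult d_abs)
      from Re_prod_summable[OF this that(2)] show ?thesis
        by (simp add: mult.assoc)
    qed
    have sym_l: "(\<Sum>\<^sub>\<infinity>i. Re (d i * (f i * ?Tl g i))) = (\<Sum>\<^sub>\<infinity>i. Re (d i * (g i * ?Tl f i)))"
      if f: "f \<in> ell2" and g: "g \<in> ell2" for f g
    proof -
      have split: "(\<Sum>\<^sub>\<infinity>i. Re (d i * (u i * ?Tl v i)))
          = (\<Sum>\<^sub>\<infinity>i. Re (d i * (u i * T v i))) + (\<Sum>\<^sub>\<infinity>i. Re (d i * (u i * ((-l) * v i))))"
        if "u \<in> ell2" "v \<in> ell2" for u v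
      proof -
        have "(\<lambda>i. Re (d i * (u i * ((-l) * v i)))) summable_on UNIV"
          using summable[OF that(1) ell2_scale[OF that(2), of "-l"]] .
        then have "(\<Sum>\<^sub>\<infinity>i. Re (d i * (u i * T v i)) + Re (d i * (u i * ((-l) * v i))))
          = (\<Sum>\<^sub>\<infinity>i. Re (d i * (u i * T v i))) + (\<Sum>\<^sub>\<infinity>i. Re (d i * (u i * ((-l) * v i))))"
          by (rule infsum_add[OF summable[OF that(1) mem[OF that(2)]]])
        then show ?thesis
          by (simp add: algebra_simps)
      qed
      show ?thesis
        unfolding split[OF f g] split[OF g f] sym[OF f g] by (simp add: mult.left_commute mult.commute)
    qed
    have inj: "x = y" if x: "x \<in> ell2" and y: "y \<in> ell2" and eq: "?Tl x = ?Tl y" for x y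
    proof -
      have xy: "(\<lambda>i. x i - y i) \<in> ell2"
        by (intro ell2_diff x y)
      have "?Tl (\<lambda>i. x i - y i) = (\<lambda>i. 0)"
        unfolding Tl.diff using eq by (simp add: fun_eq_iff)
      then have "\<nu> * ell2_norm (\<lambda>i. x i - y i) \<le> 0"
        using below[OF xy] by (simp add: ell2_norm_def)
      then have "ell2_norm (\<lambda>i. x i - y i) = 0"
        using \<nu> ell2_norm_nonneg[of "\<lambda>i. x i - y i"] by (simp add: mult_le_0_iff)
      from ell2_norm_eq_0D[OF xy this] show ?thesis
        by (auto simp: fun_eq_iff)
    qed
    have ex: "\<exists>x. x \<in> ell2 \<and> ?Tl x = f" if "f \<in> ell2" for f
      using Tl.surjective_if_symmetric[OF d sym_l \<nu> below that] by blast
    define R where "R f = (SOME x. x \<in> ell2 \<and> ?Tl x = f)" for f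
    have R: "R f \<in> ell2" "?Tl (R f) = f" if "f \<in> ell2" for f
      using someI_ex[OF ex[OF that]] by (simp_all add: R_def)
    have R_apply: "T (R f) i - l * R f i = f i" if "f \<in> ell2" for f i
      using fun_cong[OF R(2)[OF that], of i] .
    have R_eq: "R f = x" if "x \<in> ell2" "?Tl x = f" for f x
      using that R[of f] Tl.mem[of x] inj[of "R f" x] by auto
    have "bounded_op R"
      unfolding bounded_op_def
    proof (intro conjI ballI allI exI)
      fix f g :: "'i \<Rightarrow> complex" and a assume f: "f \<in> ell2"
      then show "R f \<in> ell2" by (rule R)
      show "ell2_norm (R f) \<le> (1 / \<nu>) * ell2_norm f"
        using below[OF R(1)[OF f]] \<nu> by (simp add: R(2)[OF f] field_simps)
      show "R (\<lambda>i. a * f i) = (\<lambda>i. a * R f i)"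
        by (rule R_eq) (simp_all only: Tl.scale R_apply[OF f] ell2_scale[OF R(1)[OF f]])
      assume g: "g \<in> ell2"
      show "R (\<lambda>i. f i + g i) = (\<lambda>i. R f i + R g i)"
        by (rule R_eq) (simp_all only: Tl.add R_apply[OF f] R_apply[OF g] ell2_add[OF R(1)[OF f] R(1)[OF g]])
    qed
    moreover have "R (?Tl f) = f \<and> ?Tl (R f) = f" if "f \<in> ell2" for f
      using R_eq[OF that] R(2)[OF that] by simp
    ultimately have "l \<notin> Spec T"
      unfolding Spec_def by blast
    with \<open>l \<in> Spec T\<close> show False by simp
  qed
qed


text \<open>This reduces the symmetry of a tridiagonal matrix with zero diagonal to the statement that its
  lower part \<open>L\<close> and its upper part \<open>R\<close> are transposes of each other up to the signs \<open>d\<close>.\<close>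

lemma infsum_Re_symmetric_split:
  fixes d :: "'i \<Rightarrow> real" and L R :: "('i \<Rightarrow> complex) \<Rightarrow> ('i \<Rightarrow> complex)"
  assumes d: "\<And>i. d i = 1 \<or> d i = -1"
    and L: "\<And>f. f \<in> ell2 \<Longrightarrow> L f \<in> ell2" and R: "\<And>f. f \<in> ell2 \<Longrightarrow> R f \<in> ell2"
    and transposed: "\<And>f g. f \<in> ell2 \<Longrightarrow> g \<in> ell2 \<Longrightarrow>
      (\<Sum>\<^sub>\<infinity>i. Re (d i * (f i * L g i))) = (\<Sum>\<^sub>\<infinity>i. Re (d i * (g i * R f i)))"
    and f: "f \<in> ell2" and g: "g \<in> ell2"
  shows "(\<Sum>\<^sub>\<infinity>i. Re (d i * (f i * (L g i + R g i)))) = (\<Sum>\<^sub>\<infinity>i. Re (d i * (g i * (L f i + R f i))))"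
proof -
  have d_abs: "\<bar>d i\<bar> = 1" for i
    using d[of i] by auto
  have summable: "(\<lambda>i. Re (d i * (u i * v i))) summable_on UNIV" if "u \<in> ell2" "v \<in> ell2"
    for u v :: "'i \<Rightarrow> complex"
  proof -
    have "(\<lambda>i. d i * u i) \<in> ell2"
      by (rule ell2_if_dominated[OF that(1), where h = id]) (auto simp: norm_mult d_abs)
    from Re_prod_summable[OF this that(2)] show ?thesis
      by (simp add: mult.assoc)
  qed
  have split: "(\<Sum>\<^sub>\<infinity>i. Re (d i * (u i * (L v i + R v i))))
      = (\<Sum>\<^sub>\<infinity>i. Re (d i * (u i * L v i))) + (\<Sum>\<^sub>\<infinity>i. Re (d i * (u i * R v i)))"
    if "u \<in> ell2" "v \<in> ell2" for u v
    using infsum_add[OF summable[OF that(1) L[OF that(2)]] summable[OF that(1) R[OF that(2)]]]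
    by (simp add: algebra_simps)
  show ?thesis
    unfolding split[OF f g] split[OF g f] transposed[OF f g] transposed[OF g f] by simp
qed

lemma abs_sign_le_1:
  fixes b :: "'i \<Rightarrow> real"
  assumes "range b \<subseteq> {1, -1}"
  shows "\<bar>b i\<bar> \<le> 1"
proof -
  have "b i \<in> {1, -1}"
    using assms by blast
  then show ?thesis by auto
qed

lemma prod_signs:
  fixes b :: "'i \<Rightarrow> real"
  assumes "range b \<subseteq> {1, -1}"
  shows "(\<Prod>i\<in>A. b i) = 1 \<or> (\<Prod>i\<in>A. b i) = -1"
proof (induction A rule: infinite_finite_induct)
  case (insert x F)
  have "b x \<in> {1, -1}"
    using assms by blast
  with insert show ?case by auto
qed auto

section \<open>Hopping operators\<close>

lemma
  fixes f :: "nat \<Rightarrow> complex"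
  assumes c: "\<And>n. \<bar>c n\<bar> \<le> 1" and f: "f \<in> ell2"
  shows nat_lower_mem: "(\<lambda>i. if i = 0 then 0 else of_real (c (i - 1)) * f (i - 1)) \<in> ell2" (is "?L \<in> _")
    and nat_lower_bound: "ell2_norm (\<lambda>i. if i = 0 then 0 else of_real (c (i - 1)) * f (i - 1)) \<le> ell2_norm f"
    and nat_upper_mem: "(\<lambda>i. f (i + 1)) \<in> ell2"
    and nat_upper_bound: "ell2_norm (\<lambda>i. f (i + 1)) \<le> ell2_norm f"
proof -
  have inj: "inj_on (\<lambda>i. i - 1) {i. ?L i \<noteq> 0}"
  proof (rule inj_onI)
    fix x y assume "x \<in> {i. ?L i \<noteq> 0}" "y \<in> {i. ?L i \<noteq> 0}" and eq: "x - 1 = y - 1"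
    then have "x \<noteq> 0" "y \<noteq> 0"
      by (auto split: if_splits)
    with eq show "x = y" by linarith
  qed
  have le: "cmod (?L i) \<le> cmod (f (i - 1))" if "?L i \<noteq> 0" for i
    using c[of "i - 1"] by (auto simp: norm_mult intro: mult_left_le_one_le)
  show "?L \<in> ell2" "ell2_norm ?L \<le> ell2_norm f"
    using ell2_if_dominated[OF f inj le] ell2_norm_le_if_dominated[OF f inj le] by blast+
  show "(\<lambda>i. f (i + 1)) \<in> ell2" "ell2_norm (\<lambda>i. f (i + 1)) \<le> ell2_norm f"
    using ell2_if_dominated[OF f, of "\<lambda>i. i + 1" "\<lambda>i. f (i + 1)"]
      ell2_norm_le_if_dominated[OF f, of "\<lambda>i. i + 1" "\<lambda>i. f (i + 1)"]
    by (auto simp: inj_on_def)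
qed

lemma
  fixes f :: "int \<Rightarrow> complex"
  assumes b: "\<And>n. \<bar>b n\<bar> \<le> 1" and f: "f \<in> ell2"
  shows int_lower_mem: "(\<lambda>i::int. of_real (b i) * f (i - 1)) \<in> ell2" (is "?L \<in> _")
    and int_lower_bound: "ell2_norm (\<lambda>i::int. of_real (b i) * f (i - 1)) \<le> ell2_norm f"
    and int_upper_mem: "(\<lambda>i. f (i + 1)) \<in> ell2"
    and int_upper_bound: "ell2_norm (\<lambda>i. f (i + 1)) \<le> ell2_norm f"
proof -
  have inj: "inj_on (\<lambda>i. i - 1) {i. ?L i \<noteq> 0}"
    by (auto simp: inj_on_def)
  have le: "cmod (?L i) \<le> cmod (f (i - 1))" if "?L i \<noteq> 0" for i
    using b[of i] by (auto simp: norm_mult intro: mult_left_le_one_le)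
  show "?L \<in> ell2" "ell2_norm ?L \<le> ell2_norm f"
    using ell2_if_dominated[OF f inj le] ell2_norm_le_if_dominated[OF f inj le] by blast+
  show "(\<lambda>i. f (i + 1)) \<in> ell2" "ell2_norm (\<lambda>i. f (i + 1)) \<le> ell2_norm f"
    using ell2_if_dominated[OF f, of "\<lambda>i. i + 1" "\<lambda>i. f (i + 1)"]
      ell2_norm_le_if_dominated[OF f, of "\<lambda>i. i + 1" "\<lambda>i. f (i + 1)"]
    by (auto simp: inj_on_def)
qed

lemma ell2_operator_A_plus:
  assumes c: "\<And>n. \<bar>c n\<bar> \<le> 1"
  shows "ell2_operator (A_plus c) 2"
proof
  fix f :: "nat \<Rightarrow> complex" assume f: "f \<in> ell2"
  note facts = nat_lower_mem[where c = c, OF c f] nat_upper_mem[where c = c, OF c f]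
  show "A_plus c f \<in> ell2"
    unfolding A_plus_apply[abs_def] by (rule ell2_add[OF facts])
  show "ell2_norm (A_plus c f) \<le> 2 * ell2_norm f"
    unfolding A_plus_apply[abs_def]
    using ell2_norm_triangle[OF facts] nat_lower_bound[where c = c, OF c f]
      nat_upper_bound[where c = c, OF c f] by linarith
next
  fix F :: "nat \<Rightarrow> nat \<Rightarrow> complex" and h i assume "\<And>j. (\<lambda>n. F n j) \<longlonglongrightarrow> h j"
  then show "(\<lambda>n. A_plus c (F n) i) \<longlonglongrightarrow> A_plus c h i"
    unfolding A_plus_apply by (cases "i = 0") (auto intro!: tendsto_intros)
qed (auto simp: A_plus_apply fun_eq_iff algebra_simps)

lemma ell2_operator_A_bi:
  assumes b: "\<And>n. \<bar>b n\<bar> \<le> 1"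
  shows "ell2_operator (A_bi b) 2"
proof
  fix f :: "int \<Rightarrow> complex" assume f: "f \<in> ell2"
  note facts = int_lower_mem[where b = b, OF b f] int_upper_mem[where b = b, OF b f]
  show "A_bi b f \<in> ell2"
    unfolding A_bi_def by (rule ell2_add[OF facts])
  show "ell2_norm (A_bi b f) \<le> 2 * ell2_norm f"
    unfolding A_bi_def
    using ell2_norm_triangle[OF facts] int_lower_bound[where b = b, OF b f]
      int_upper_bound[where b = b, OF b f] by linarith
next
  fix F :: "nat \<Rightarrow> int \<Rightarrow> complex" and h i assume "\<And>j. (\<lambda>n. F n j) \<longlonglongrightarrow> h j"
  then show "(\<lambda>n. A_bi b (F n) i) \<longlonglongrightarrow> A_bi b h i"
    unfolding A_bi_def by (intro tendsto_intros)
qed (auto simp: A_bi_def fun_eq_iff algebra_simps)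

lemma Spec_A_plus_eq_approx_spectrum:
  assumes c: "range c \<subseteq> {1, -1}"
  shows "Spec (A_plus c) = approx_spectrum (A_plus c)"
proof -
  have c1: "c n = 1 \<or> c n = -1" for n
    using c by auto
  have c_abs: "\<bar>c n\<bar> \<le> 1" for n
    by (rule abs_sign_le_1[OF c])
  interpret ell2_operator "A_plus c" 2
    by (rule ell2_operator_A_plus[OF c_abs])
  \<comment> \<open>Symmetry of \<open>d\<^sub>i A\<^sub>i\<^sub>j\<close> at the positions \<open>(n, n + 1)\<close> and \<open>(n + 1, n)\<close> demands
    \<open>d\<^sub>n = d\<^bsub>n+1\<^esub> c\<^sub>n\<close>.\<close>
  define d where "d n = (\<Prod>k<n. c k)" for n
  have d: "d n = 1 \<or> d n = -1" for n
    unfolding d_def by (rule prod_signs[OF c])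
  have dc: "d (Suc n) * c n = d n" for n
    using c1[of n] by (auto simp: d_def)
  show ?thesis
  proof (rule Spec_eq_approx_spectrum_if_symmetric[OF d])
    fix f g :: "nat \<Rightarrow> complex" assume fg: "f \<in> ell2" "g \<in> ell2"
    show "(\<Sum>\<^sub>\<infinity>i. Re (d i * (f i * A_plus c g i))) = (\<Sum>\<^sub>\<infinity>i. Re (d i * (g i * A_plus c f i)))"
      unfolding A_plus_apply
    proof (rule infsum_Re_symmetric_split[OF d nat_lower_mem[where c = c, OF c_abs]
          nat_upper_mem[where c = c, OF c_abs] _ fg])
      fix f g :: "nat \<Rightarrow> complex"
      let ?l = "\<lambda>i. Re (d i * (f i * (if i = 0 then 0 else of_real (c (i - 1)) * g (i - 1))))"
      have "infsum ?l UNIV = infsum ?l (range Suc)"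
        by (rule infsum_cong_neutral) (auto simp: image_iff gr0_conv_Suc)
      also have "\<dots> = infsum (?l \<circ> Suc) UNIV"
        by (rule infsum_reindex) simp
      also have "?l \<circ> Suc = (\<lambda>i. Re (d i * (g i * f (i + 1))))"
      proof
        fix i
        have "complex_of_real (d (Suc i)) * (f (Suc i) * (c i * g i)) = d i * (g i * f (Suc i))"
          by (simp add: dc[of i, symmetric] mult_ac)
        from arg_cong[OF this, of Re] show "(?l \<circ> Suc) i = Re (d i * (g i * f (i + 1)))"
          by simp
      qed
      finally show "infsum ?l UNIV = (\<Sum>\<^sub>\<infinity>i. Re (d i * (g i * f (i + 1))))" .
    qed
  qed
qed

lemma Spec_A_bi_eq_approx_spectrum:
  assumes b: "range b \<subseteq> {1, -1}"
  shows "Spec (A_bi b) = approx_spectrum (A_bi b)"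
proof -
  have b1: "b n = 1 \<or> b n = -1" for n
    using b by auto
  have b_abs: "\<bar>b n\<bar> \<le> 1" for n
    by (rule abs_sign_le_1[OF b])
  interpret ell2_operator "A_bi b" 2
    by (rule ell2_operator_A_bi[OF b_abs])
  \<comment> \<open>One product is empty for \<open>n \<le> 0\<close>, the other for \<open>n \<ge> 0\<close>; together they solve
    \<open>d\<^sub>n b\<^sub>n = d\<^bsub>n-1\<^esub>\<close> on both sides of \<open>0\<close>.\<close>
  define d where "d n = (\<Prod>k\<in>{1..n}. b k) * (\<Prod>k\<in>{n + 1..0}. b k)" for n
  have prod: "(\<Prod>k\<in>A. b k) = 1 \<or> (\<Prod>k\<in>A. b k) = -1" for A
    by (rule prod_signs[OF b])
  have d: "d n = 1 \<or> d n = -1" for n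
    using prod[of "{1..n}"] prod[of "{n + 1..0}"] by (auto simp: d_def)
  have db: "d n * b n = d (n - 1)" for n
  proof (cases "n \<ge> 1")
    case True
    then have "{1..n} = insert n {1..n - 1}" by auto
    with True show ?thesis
      using b1[of n] by (auto simp: d_def)
  next
    case False
    then have "{n..0} = insert n {n + 1..0}" by auto
    with False show ?thesis
      by (simp add: d_def)
  qed
  show ?thesis
  proof (rule Spec_eq_approx_spectrum_if_symmetric[OF d])
    fix f g :: "int \<Rightarrow> complex" assume fg: "f \<in> ell2" "g \<in> ell2"
    show "(\<Sum>\<^sub>\<infinity>i. Re (d i * (f i * A_bi b g i))) = (\<Sum>\<^sub>\<infinity>i. Re (d i * (g i * A_bi b f i)))"
      unfolding A_bi_def
    proof (rule infsum_Re_symmetric_split[OF d int_lower_mem[where b = b, OF b_abs]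
          int_upper_mem[where b = b, OF b_abs] _ fg])
      fix f g :: "int \<Rightarrow> complex"
      have bij: "bij_betw (\<lambda>i::int. i - 1) UNIV UNIV"
        by (rule bij_betw_byWitness[where f' = "\<lambda>i. i + 1"]) auto
      have "(\<Sum>\<^sub>\<infinity>i. Re (d i * (f i * (of_real (b i) * g (i - 1)))))
          = (\<Sum>\<^sub>\<infinity>i. Re (d (i - 1) * (g (i - 1) * f (i - 1 + 1))))"
      proof (rule infsum_cong)
        fix i
        have "complex_of_real (d i) * (f i * (b i * g (i - 1))) = d (i - 1) * (g (i - 1) * f i)"
          by (simp add: db[of i, symmetric] mult_ac)
        then show "Re (d i * (f i * (of_real (b i) * g (i - 1))))
            = Re (d (i - 1) * (g (i - 1) * f (i - 1 + 1)))"
          by (simp only: diff_add_cancel)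
      qed
      also have "\<dots> = (\<Sum>\<^sub>\<infinity>i. Re (d i * (g i * f (i + 1))))"
        by (rule infsum_reindex_bij_betw[OF bij, where f = "\<lambda>i. Re (d i * (g i * f (i + 1)))"])
      finally show "(\<Sum>\<^sub>\<infinity>i. Re (d i * (f i * (of_real (b i) * g (i - 1)))))
          = (\<Sum>\<^sub>\<infinity>i. Re (d i * (g i * f (i + 1))))" .
    qed
  qed
qed

section \<open>Transplanting approximate eigenvectors\<close>

lemma finite_int_support_bounded:
  fixes f :: "int \<Rightarrow> complex"
  assumes "finite {i. f i \<noteq> 0}"
  obtains N :: nat where "\<And>i. f i \<noteq> 0 \<Longrightarrow> - int N \<le> i \<and> i \<le> int N"
proof
  define N where "N = nat (Max (insert 0 (abs ` {i. f i \<noteq> 0})))"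
  have N: "int N = Max (insert 0 (abs ` {i. f i \<noteq> 0}))"
    using assms by (simp add: N_def)
  fix i assume "f i \<noteq> 0"
  then have "\<bar>i\<bar> \<le> Max (insert 0 (abs ` {i. f i \<noteq> 0}))"
    using assms by (intro Max_ge) auto
  then show "- int N \<le> i \<and> i \<le> int N"
    unfolding N[symmetric] by linarith
qed

text \<open>If a vector is supported in \<open>{-N..N}\<close>, then \<open>A_bi b\<close> applies to it the weights with indices
  \<open>-N + 1\<close> to \<open>N + 1\<close> only; the window covers these.\<close>

definition sign_window :: "(int \<Rightarrow> real) \<Rightarrow> nat \<Rightarrow> real list" where
  "sign_window b N = map (\<lambda>k. b (int k - int N)) [0..<2 * N + 2]"

lemma pseudo_ergodic_sign_window:
  fixes c :: "'i::semiring_1 \<Rightarrow> real"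
  assumes "pseudo_ergodic 1 c" "range b \<subseteq> {1, -1}"
  obtains n where "\<And>k. k < 2 * N + 2 \<Longrightarrow> c (n + of_nat k) = b (int k - int N)"
proof -
  have "set (sign_window b N) \<subseteq> {1, -1}"
    using assms(2) by (auto simp: sign_window_def)
  then obtain n where "\<forall>k<length (sign_window b N). c (n + of_nat k) = sign_window b N ! k"
    using assms(1) unfolding pseudo_ergodic_def by blast
  then have "c (n + of_nat k) = b (int k - int N)" if "k < 2 * N + 2" for k
    using that by (auto simp: sign_window_def simp del: upt_Suc)
  then show thesis
    using that by blast
qed

lemma transplant_to_bi_infinite:
  fixes f :: "int \<Rightarrow> complex"
  assumes pe: "pseudo_ergodic 1 b'" and b: "range b \<subseteq> {1, -1}" "range b' \<subseteq> {1, -1}"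
    and fin: "finite {i. f i \<noteq> 0}"
  obtains g where "finite {i. g i \<noteq> 0}" "ell2_norm f \<le> ell2_norm g"
    "ell2_norm (\<lambda>i. A_bi b' g i - l * g i) \<le> ell2_norm (\<lambda>i. A_bi b f i - l * f i)"
proof -
  have b_abs: "\<bar>b n\<bar> \<le> 1" for n
    by (rule abs_sign_le_1[OF b(1)])
  interpret ell2_operator "A_bi b" 2
    by (rule ell2_operator_A_bi[OF b_abs])
  interpret Tl: ell2_operator "\<lambda>f i. A_bi b f i - l * f i" "2 + cmod l"
    by (rule shifted)
  obtain N where N: "\<And>i. f i \<noteq> 0 \<Longrightarrow> - int N \<le> i \<and> i \<le> int N"
    using finite_int_support_bounded[OF fin] by blast
  obtain n where n: "\<And>k. k < 2 * N + 2 \<Longrightarrow> b' (n + of_nat k) = b (int k - int N)"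
    using pseudo_ergodic_sign_window[OF pe b(1)] by blast
  define m where "m = n + int N"
  define g where "g j = f (j - m)" for j
  have fin_g: "finite {i. g i \<noteq> 0}"
  proof -
    have "{i. g i \<noteq> 0} \<subseteq> (\<lambda>i. i + m) ` {i. f i \<noteq> 0}"
      by (auto simp: g_def image_iff intro!: exI[of _ "_ - m"])
    then show ?thesis
      using fin finite_surj by blast
  qed
  have res: "A_bi b' g j - l * g j = A_bi b f (j - m) - l * f (j - m)" for j
  proof (cases "f (j - m - 1) = 0")
    case True
    then show ?thesis
      by (simp add: A_bi_def g_def algebra_simps)
  next
    case False
    then have "- int N \<le> j - m - 1 \<and> j - m - 1 \<le> int N"
      by (rule N)
    then have "nat (j - n) < 2 * N + 2" "int (nat (j - n)) = j - n"
      by (simp_all add: m_def nat_less_iff)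
    then have "b' j = b (j - m)"
      using n[of "nat (j - n)"] by (simp add: m_def diff_diff_eq)
    then show ?thesis
      by (simp add: A_bi_def g_def algebra_simps)
  qed
  show thesis
  proof (rule that[OF fin_g])
    show "ell2_norm f \<le> ell2_norm g"
      by (rule ell2_norm_le_if_eq[OF ell2_finite_support[OF fin_g], where h = "\<lambda>i. i + m"])
        (auto simp: g_def)
    show "ell2_norm (\<lambda>i. A_bi b' g i - l * g i) \<le> ell2_norm (\<lambda>i. A_bi b f i - l * f i)"
      by (rule ell2_norm_le_if_eq[OF Tl.mem[OF ell2_finite_support[OF fin]], where h = "\<lambda>i. i - m"])
        (auto simp: res inj_on_def)
  qed
qed

lemma transplant_to_semi_infinite:
  fixes f :: "int \<Rightarrow> complex"
  assumes pe: "pseudo_ergodic 1 c" and b: "range b \<subseteq> {1, -1}"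
    and fin: "finite {i. f i \<noteq> 0}"
  obtains g where "finite {i. g i \<noteq> 0}" "ell2_norm f \<le> ell2_norm g"
    "ell2_norm (\<lambda>i. A_plus c g i - l * g i) \<le> ell2_norm (\<lambda>i. A_bi b f i - l * f i)"
proof -
  have b_abs: "\<bar>b n\<bar> \<le> 1" for n
    by (rule abs_sign_le_1[OF b])
  interpret ell2_operator "A_bi b" 2
    by (rule ell2_operator_A_bi[OF b_abs])
  interpret Tl: ell2_operator "\<lambda>f i. A_bi b f i - l * f i" "2 + cmod l"
    by (rule shifted)
  obtain N where N: "\<And>i. f i \<noteq> 0 \<Longrightarrow> - int N \<le> i \<and> i \<le> int N"
    using finite_int_support_bounded[OF fin] by blast
  obtain n :: nat where n: "\<And>k. k < 2 * N + 2 \<Longrightarrow> c (n + k) = b (int k - int N)"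
    using pseudo_ergodic_sign_window[OF pe b, of N] by auto
  \<comment> \<open>The entry of \<open>c\<close> in row \<open>j\<close> is \<open>c (j - 1)\<close>, hence the extra \<open>1\<close>; it also
    leaves row \<open>0\<close> to the left of the transplanted support.\<close>
  define m where "m = int n + int N + 1"
  define g where "g j = f (int j - m)" for j
  have fin_g: "finite {i. g i \<noteq> 0}"
  proof -
    have "{i. g i \<noteq> 0} \<subseteq> (\<lambda>i. nat (i + m)) ` {i. f i \<noteq> 0}"
      by (auto simp: g_def image_iff intro!: exI[of _ "int _ - m"])
    then show ?thesis
      using fin finite_surj by blast
  qed
  have res: "A_plus c g j - l * g j = A_bi b f (int j - m) - l * f (int j - m)" for j
  proof (cases "f (int j - m - 1) = 0")
    case True
    then show ?thesis
      by (cases j) (simp_all add: A_bi_def A_plus_apply g_def algebra_simps)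
  next
    case False
    then have j: "- int N \<le> int j - m - 1 \<and> int j - m - 1 \<le> int N"
      by (rule N)
    then have "c (j - 1) = b (int j - m)" "j > 0"
      using n[of "j - 1 - n"] by (auto simp: m_def of_nat_diff algebra_simps)
    then show ?thesis
      by (cases j) (simp_all add: A_bi_def A_plus_apply g_def algebra_simps)
  qed
  show thesis
  proof (rule that[OF fin_g])
    have "inj_on (\<lambda>i. nat (i + m)) {i. f i \<noteq> 0}"
      using N by (force simp: inj_on_def m_def)
    moreover have "f i = g (nat (i + m))" if "f i \<noteq> 0" for i
      using N[OF that] by (simp add: g_def m_def)
    ultimately show "ell2_norm f \<le> ell2_norm g"
      by (rule ell2_norm_le_if_eq[OF ell2_finite_support[OF fin_g]])
    show "ell2_norm (\<lambda>i. A_plus c g i - l * g i) \<le> ell2_norm (\<lambda>i. A_bi b f i - l * f i)"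
      by (rule ell2_norm_le_if_eq[OF Tl.mem[OF ell2_finite_support[OF fin]], where h = "\<lambda>i. int i - m"])
        (auto simp: res inj_on_def)
  qed
qed

text \<open>Index \<open>n\<close> of the half-line becomes the position \<open>n + 1\<close>, its mirror image is \<open>- (n + 1)\<close>, and
  the vector vanishes at \<open>0\<close>. The mirrored copy carries the signs \<open>s\<^sub>n\<close>, which turn the mirrored
  matrix, in which the weights \<open>c\<close> sit above the diagonal, back into one with \<open>1\<close> above the
  diagonal. The two copies cancel in row \<open>0\<close>, so the error is that of \<open>x\<close>, occurring twice.\<close>

lemma reflection_to_bi_infinite:
  fixes x :: "nat \<Rightarrow> complex"
  assumes c: "range c \<subseteq> {1, -1}" and fin: "finite {i. x i \<noteq> 0}"
  obtains b f where "range b \<subseteq> {1, -1}" "finite {i. f i \<noteq> 0}" "ell2_norm x \<le> ell2_norm f"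
    "ell2_norm (\<lambda>i. A_bi b f i - l * f i) \<le> 2 * ell2_norm (\<lambda>i. A_plus c x i - l * x i)"
proof -
  have c1: "c n = 1 \<or> c n = -1" for n
    using c by auto
  have c_abs: "\<bar>c n\<bar> \<le> 1" for n
    by (rule abs_sign_le_1[OF c])
  interpret ell2_operator "A_plus c" 2
    by (rule ell2_operator_A_plus[OF c_abs])
  interpret Tl: ell2_operator "\<lambda>f i. A_plus c f i - l * f i" "2 + cmod l"
    by (rule shifted)
  define s where "s n = (\<Prod>k<n. c k)" for n
  have s: "s n = 1 \<or> s n = -1" for n
    unfolding s_def by (rule prod_signs[OF c])
  have s_Suc: "s (Suc n) = s n * c n" for n
    by (simp add: s_def)
  \<comment> \<open>\<open>b 1\<close> multiplies the value at \<open>0\<close> and is arbitrary; \<open>b 0 = -1\<close> makes the neighbours of \<open>0\<close>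
    cancel.\<close>
  define b where "b p = (if p \<ge> 2 then c (nat (p - 2)) else if p = 1 then 1
      else if p = 0 then -1 else c (nat (- p - 1)))" for p :: int
  define f where "f p = (if p \<ge> 1 then x (nat (p - 1)) else if p = 0 then 0
      else s (nat (- p - 1)) * x (nat (- p - 1)))" for p :: int
  define r where "r i = A_plus c x i - l * x i" for i
  define r1 where "r1 p = (if p \<ge> 1 then r (nat (p - 1)) else 0)" for p :: int
  define r2 where "r2 p = (if p \<le> -1 then s (nat (- p - 1)) * r (nat (- p - 1)) else 0)" for p :: int
  have r: "r \<in> ell2"
    unfolding r_def[abs_def] by (intro Tl.mem ell2_finite_support fin)
  have b: "range b \<subseteq> {1, -1}"
    using c1 by (auto simp: b_def)
  have fin_f: "finite {p. f p \<noteq> 0}"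
  proof (rule finite_subset)
    show "{p. f p \<noteq> 0} \<subseteq> (\<lambda>n. int n + 1) ` {i. x i \<noteq> 0} \<union> (\<lambda>n. - int n - 1) ` {i. x i \<noteq> 0}"
    proof
      fix p assume "p \<in> {p. f p \<noteq> 0}"
      then consider "p \<ge> 1" "x (nat (p - 1)) \<noteq> 0" | "p \<le> -1" "x (nat (- p - 1)) \<noteq> 0"
        by (auto simp: f_def split: if_splits)
      then show "p \<in> (\<lambda>n. int n + 1) ` {i. x i \<noteq> 0} \<union> (\<lambda>n. - int n - 1) ` {i. x i \<noteq> 0}"
        by cases (force simp: image_iff)+
    qed
  qed (use fin in auto)
  have res: "A_bi b f p - l * f p = r1 p + r2 p" for p
  proof -
    consider "p = 0" | n where "p = int n + 1" | n where "p = - int n - 1"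
    proof (cases "p = 0")
      case False
      then have "p = int (nat (p - 1)) + 1 \<or> p = - int (nat (- p - 1)) - 1"
        by auto
      then show ?thesis
        using that by blast
    qed
    then show ?thesis
    proof cases
      case 1
      then show ?thesis
        by (simp add: A_bi_def r1_def r2_def f_def b_def s_def)
    next
      case (2 n)
      then show ?thesis
        by (cases n) (auto simp: A_bi_def A_plus_apply r_def r1_def r2_def f_def b_def nat_add_distrib)
    next
      case (3 n)
      show ?thesis
      proof (cases n)
        case 0
        with 3 show ?thesis
          using c1[of 0] by (auto simp: A_bi_def A_plus_apply r_def r1_def r2_def f_def b_def s_def)
      next
        case (Suc k)
        have "f (p - 1) = s (Suc n) * x (Suc n)" "f (p + 1) = s k * x k" "f p = s n * x n"
          "b p = c n"
          using 3 Suc by (simp_all add: f_def b_def nat_add_distrib)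
        moreover have "r1 p = 0" "r2 p = s n * r n"
          using 3 by (simp_all add: r1_def r2_def)
        ultimately show ?thesis
          using c1[of n] c1[of k] Suc
          by (auto simp: A_bi_def A_plus_apply r_def s_Suc algebra_simps)
      qed
    qed
  qed
  have r1: "r1 \<in> ell2" "ell2_norm r1 \<le> ell2_norm r"
  proof -
    have inj: "inj_on (\<lambda>p. nat (p - 1)) {p. r1 p \<noteq> 0}"
      by (auto simp: inj_on_def r1_def split: if_splits)
    have le: "cmod (r1 p) \<le> cmod (r (nat (p - 1)))" if "r1 p \<noteq> 0" for p
      by (simp add: r1_def)
    show "r1 \<in> ell2" "ell2_norm r1 \<le> ell2_norm r"
      using ell2_if_dominated[OF r inj le] ell2_norm_le_if_dominated[OF r inj le] by blast+
  qed
  have r2: "r2 \<in> ell2" "ell2_norm r2 \<le> ell2_norm r"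
  proof -
    have inj: "inj_on (\<lambda>p. nat (- p - 1)) {p. r2 p \<noteq> 0}"
      by (auto simp: inj_on_def r2_def split: if_splits)
    have le: "cmod (r2 p) \<le> cmod (r (nat (- p - 1)))" if "r2 p \<noteq> 0" for p
      using s[of "nat (- p - 1)"] by (auto simp: r2_def norm_mult)
    show "r2 \<in> ell2" "ell2_norm r2 \<le> ell2_norm r"
      using ell2_if_dominated[OF r inj le] ell2_norm_le_if_dominated[OF r inj le] by blast+
  qed
  show thesis
  proof (rule that[OF b fin_f])
    show "ell2_norm x \<le> ell2_norm f"
      by (rule ell2_norm_le_if_eq[OF ell2_finite_support[OF fin_f], where h = "\<lambda>i. int i + 1"])
        (auto simp: f_def inj_on_def)
    have "ell2_norm (\<lambda>p. r1 p + r2 p) \<le> 2 * ell2_norm r"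
      using ell2_norm_triangle[OF r1(1) r2(1)] r1(2) r2(2) by linarith
    then show "ell2_norm (\<lambda>i. A_bi b f i - l * f i) \<le> 2 * ell2_norm (\<lambda>i. A_plus c x i - l * x i)"
      by (simp add: res r_def[abs_def])
  qed
qed

text \<open>The common value of all the spectra: the signs may be chosen anew for each accuracy \<open>e\<close>, and no
  pseudo-ergodic sequence occurs.\<close>

definition sign_hopping_approx_spectrum :: "complex set" where
  "sign_hopping_approx_spectrum = {l. \<forall>e>0. \<exists>b f. range b \<subseteq> {1, -1} \<and> finite {i. f i \<noteq> 0} \<and>
     ell2_norm (\<lambda>i. A_bi b f i - l * f i) < e * ell2_norm f}"

lemma Spec_A_bi_pseudo_ergodic:
  assumes b: "range b \<subseteq> {1, -1}" and pe: "pseudo_ergodic 1 b"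
  shows "Spec (A_bi b) = sign_hopping_approx_spectrum"
  unfolding Spec_A_bi_eq_approx_spectrum[OF b]
proof (intro equalityI subsetI)
  fix l assume "l \<in> approx_spectrum (A_bi b)"
  then show "l \<in> sign_hopping_approx_spectrum"
    using b unfolding approx_spectrum_def sign_hopping_approx_spectrum_def by blast
next
  fix l assume l: "l \<in> sign_hopping_approx_spectrum"
  show "l \<in> approx_spectrum (A_bi b)"
    unfolding approx_spectrum_def mem_Collect_eq
  proof (intro allI impI)
    fix e :: real assume e: "e > 0"
    then obtain b' f where f: "range b' \<subseteq> {1, -1}" "finite {i. f i \<noteq> 0}"
      "ell2_norm (\<lambda>i. A_bi b' f i - l * f i) < e * ell2_norm f"
      using l unfolding sign_hopping_approx_spectrum_def by blast
    obtain g where g: "finite {i. g i \<noteq> 0}" "ell2_norm f \<le> ell2_norm g"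
      "ell2_norm (\<lambda>i. A_bi b g i - l * g i) \<le> ell2_norm (\<lambda>i. A_bi b' f i - l * f i)"
      using transplant_to_bi_infinite[OF pe f(1) b f(2)] .
    have "ell2_norm (\<lambda>i. A_bi b g i - l * g i) < e * ell2_norm g"
      using g(3) f(3) mult_left_mono[OF g(2), of e] e by linarith
    with g(1) show "\<exists>g. finite {i. g i \<noteq> 0} \<and>
        ell2_norm (\<lambda>i. A_bi b g i - l * g i) < e * ell2_norm g"
      by blast
  qed
qed

lemma Spec_A_plus_pseudo_ergodic:
  assumes c: "range c \<subseteq> {1, -1}" and pe: "pseudo_ergodic 1 c"
  shows "Spec (A_plus c) = sign_hopping_approx_spectrum"
  unfolding Spec_A_plus_eq_approx_spectrum[OF c]
proof (intro equalityI subsetI)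
  fix l assume l: "l \<in> approx_spectrum (A_plus c)"
  show "l \<in> sign_hopping_approx_spectrum"
    unfolding sign_hopping_approx_spectrum_def mem_Collect_eq
  proof (intro allI impI)
    fix e :: real assume e: "e > 0"
    then obtain x where x: "finite {i. x i \<noteq> 0}"
      "ell2_norm (\<lambda>i. A_plus c x i - l * x i) < e / 2 * ell2_norm x"
      using l half_gt_zero[OF e] unfolding approx_spectrum_def by blast
    obtain b f where f: "range b \<subseteq> {1, -1}" "finite {i. f i \<noteq> 0}" "ell2_norm x \<le> ell2_norm f"
      "ell2_norm (\<lambda>i. A_bi b f i - l * f i) \<le> 2 * ell2_norm (\<lambda>i. A_plus c x i - l * x i)"
      using reflection_to_bi_infinite[OF c x(1)] .
    have "ell2_norm (\<lambda>i. A_bi b f i - l * f i) < e * ell2_norm f"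
      using f(4) x(2) mult_left_mono[OF f(3) less_imp_le[OF e]] by simp
    with f(1,2) show "\<exists>b f. range b \<subseteq> {1, -1} \<and> finite {i. f i \<noteq> 0} \<and>
        ell2_norm (\<lambda>i. A_bi b f i - l * f i) < e * ell2_norm f"
      by blast
  qed
next
  fix l assume l: "l \<in> sign_hopping_approx_spectrum"
  show "l \<in> approx_spectrum (A_plus c)"
    unfolding approx_spectrum_def mem_Collect_eq
  proof (intro allI impI)
    fix e :: real assume e: "e > 0"
    then obtain b f where f: "range b \<subseteq> {1, -1}" "finite {i. f i \<noteq> 0}"
      "ell2_norm (\<lambda>i. A_bi b f i - l * f i) < e * ell2_norm f"
      using l unfolding sign_hopping_approx_spectrum_def by blast
    obtain g where g: "finite {i. g i \<noteq> 0}" "ell2_norm f \<le> ell2_norm g"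
      "ell2_norm (\<lambda>i. A_plus c g i - l * g i) \<le> ell2_norm (\<lambda>i. A_bi b f i - l * f i)"
      using transplant_to_semi_infinite[OF pe f(1,2)] .
    have "ell2_norm (\<lambda>i. A_plus c g i - l * g i) < e * ell2_norm g"
      using g(3) f(3) mult_left_mono[OF g(2), of e] e by linarith
    with g(1) show "\<exists>g. finite {i. g i \<noteq> 0} \<and>
        ell2_norm (\<lambda>i. A_plus c g i - l * g i) < e * ell2_norm g"
      by blast
  qed
qed

text \<open>A pseudo-ergodic sequence on the integers is needed to pin down \<open>S\<close>, since otherwise its
  description would be satisfied by every set.\<close>

lemma pseudo_ergodic_extend:
  fixes c :: "nat \<Rightarrow> real"
  assumes "pseudo_ergodic \<sigma> c"
  shows "pseudo_ergodic \<sigma> (\<lambda>i::int. c (nat i))"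
  unfolding pseudo_ergodic_def
proof (intro allI impI)
  fix w assume "set w \<subseteq> {\<sigma>, -\<sigma>}"
  then obtain n where "\<forall>k<length w. c (n + k) = w ! k"
    using assms unfolding pseudo_ergodic_def by auto
  then show "\<exists>n. \<forall>k<length w. c (nat (n + of_nat k)) = w ! k"
    by (intro exI[of _ "int n"]) (simp add: nat_add_distrib)
qed

lemma S_eq_sign_hopping_approx_spectrum:
  fixes c :: "nat \<Rightarrow> real"
  assumes "range c \<subseteq> {1, -1}" "pseudo_ergodic 1 c"
  shows "S = sign_hopping_approx_spectrum"
  unfolding S_def
proof (rule the_equality)
  show "\<forall>b. range b \<subseteq> {1, -1} \<and> pseudo_ergodic 1 b \<longrightarrow>
      Spec (A_bi b) = sign_hopping_approx_spectrum"
    using Spec_A_bi_pseudo_ergodic by blast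
  let ?b = "\<lambda>i::int. c (nat i)"
  have b: "range ?b \<subseteq> {1, -1}" "pseudo_ergodic 1 ?b"
    using assms by (auto intro: pseudo_ergodic_extend)
  fix X assume "\<forall>b. range b \<subseteq> {1, -1} \<and> pseudo_ergodic 1 b \<longrightarrow> Spec (A_bi b) = X"
  with b have "Spec (A_bi ?b) = X"
    by blast
  then show "X = sign_hopping_approx_spectrum"
    using Spec_A_bi_pseudo_ergodic[OF b] by simp
qed


section \<open>Bounded recurrences\<close>

text \<open>This is row \<open>k + 1\<close> of the equation \<open>A_plus c y = l y\<close>, solved for \<open>y (k + 2)\<close>.\<close>

fun recurrence :: "(nat \<Rightarrow> real) \<Rightarrow> complex \<Rightarrow> complex \<Rightarrow> complex \<Rightarrow> nat \<Rightarrow> complex" where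
  "recurrence c l u v 0 = u"
| "recurrence c l u v (Suc 0) = v"
| "recurrence c l u v (Suc (Suc k)) = l * recurrence c l u v (Suc k) - c k * recurrence c l u v k"

definition solves_recurrence :: "(nat \<Rightarrow> real) \<Rightarrow> complex \<Rightarrow> (nat \<Rightarrow> complex) \<Rightarrow> bool" where
  "solves_recurrence c l y \<longleftrightarrow> (\<forall>k. y (k + 2) = l * y (k + 1) - of_real (c k) * y k)"

lemma solves_recurrence_recurrence: "solves_recurrence c l (recurrence c l u v)"
  by (simp add: solves_recurrence_def numeral_eq_Suc)

text \<open>The bound must hold for all initial values, since the values with which the solution from the
  left end of the half-line enters a copy of \<open>\<beta>\<close> are beyond control.\<close>

definition bounded_recurrence :: "real \<Rightarrow> complex \<Rightarrow> bool" where
  "bounded_recurrence \<sigma> l \<longleftrightarrow> (\<exists>\<beta> M. range \<beta> \<subseteq> {\<sigma>, -\<sigma>} \<and>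
     (\<forall>y k. solves_recurrence \<beta> l y \<longrightarrow> cmod (y k) \<le> M * (cmod (y 0) + cmod (y 1))))"

lemma bounded_recurrenceI:
  assumes "range \<beta> \<subseteq> {\<sigma>, -\<sigma>}"
    and "\<And>y k. solves_recurrence \<beta> l y \<Longrightarrow> cmod (y k) \<le> M * (cmod (y 0) + cmod (y 1))"
  shows "bounded_recurrence \<sigma> l"
  using assms unfolding bounded_recurrence_def by blast

text \<open>Eliminating the odd entries gives
  \<open>y\<^bsub>2n+4\<^esub> = (l\<^sup>2 - b\<^bsub>2n+1\<^esub> - b\<^bsub>2n+2\<^esub>) y\<^bsub>2n+2\<^esub> - b\<^bsub>2n+1\<^esub> b\<^bsub>2n\<^esub> y\<^bsub>2n\<^esub>\<close>, and
  the word \<open>b\<close> is built so that this is the recurrence for \<open>\<beta>\<close> and \<open>l\<^sup>2\<close>. The odd entries are recovered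
  from \<open>l y\<^bsub>2n+1\<^esub> = y\<^bsub>2n+2\<^esub> + b\<^bsub>2n\<^esub> y\<^bsub>2n\<^esub>\<close>, where \<open>l \<noteq> 0\<close> enters.\<close>

lemma bounded_recurrence_square_root:
  assumes \<sigma>: "\<sigma> \<noteq> 0" and l: "l \<noteq> 0" and square: "bounded_recurrence (\<sigma>\<^sup>2) (l\<^sup>2)"
  shows "bounded_recurrence \<sigma> l"
proof -
  obtain \<beta> M where \<beta>: "range \<beta> \<subseteq> {\<sigma>\<^sup>2, -\<sigma>\<^sup>2}"
    and M: "\<And>y k. solves_recurrence \<beta> (l\<^sup>2) y \<Longrightarrow> cmod (y k) \<le> M * (cmod (y 0) + cmod (y 1))"
    using square unfolding bounded_recurrence_def by blast
  \<comment> \<open>\<open>\<epsilon> n\<close> will be \<open>b (2 n)\<close>: the condition on the product gives \<open>b (2 n + 1) = \<beta> n / \<epsilon> n\<close>, and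
    the condition on the sum makes \<open>b (2 n + 2)\<close> its negative.\<close>
  define \<epsilon> where "\<epsilon> = rec_nat \<sigma> (\<lambda>n e. - \<beta> n / e)"
  have \<epsilon>_Suc: "\<epsilon> (Suc n) = - \<beta> n / \<epsilon> n" for n
    by (simp add: \<epsilon>_def)
  have \<beta>_cases: "\<beta> n = \<sigma>\<^sup>2 \<or> \<beta> n = -\<sigma>\<^sup>2" for n
    using \<beta> by auto
  have \<epsilon>: "\<epsilon> n = \<sigma> \<or> \<epsilon> n = -\<sigma>" for n
  proof (induction n)
    case (Suc n)
    with \<beta>_cases[of n] \<sigma> show ?case
      by (auto simp: \<epsilon>_Suc power2_eq_square)
  qed (simp add: \<epsilon>_def)
  define b where "b k = (if even k then \<epsilon> (k div 2) else \<beta> (k div 2) / \<epsilon> (k div 2))" for k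
  have b_even: "b (2 * n) = \<epsilon> n" and b_odd: "b (2 * n + 1) = \<beta> n / \<epsilon> n" for n
    by (simp_all add: b_def)
  have b: "b k = \<sigma> \<or> b k = -\<sigma>" for k
    using \<epsilon>[of "k div 2"] \<beta>_cases[of "k div 2"] \<sigma> by (auto simp: b_def power2_eq_square)
  have b_abs: "\<bar>b k\<bar> = \<bar>\<sigma>\<bar>" for k
    using b[of k] by auto
  define C where "C = max M 0"
  define D where "D = C * (1 + cmod l + \<bar>\<sigma>\<bar>)"
  have D: "0 \<le> D"
    by (simp add: D_def C_def)
  have "cmod (y k) \<le> (D + (1 + \<bar>\<sigma>\<bar>) * D / cmod l) * (cmod (y 0) + cmod (y 1))"
    if solves: "solves_recurrence b l y" for y k
  proof -
    have y: "y (k + 2) = l * y (k + 1) - of_real (b k) * y k" for k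
      using solves by (simp add: solves_recurrence_def)
    define A where "A = cmod (y 0) + cmod (y 1)"
    have A: "0 \<le> A"
      by (simp add: A_def)
    have y2: "y (2 * (n + 2)) = l\<^sup>2 * y (2 * (n + 1)) - of_real (\<beta> n) * y (2 * n)" for n
    proof -
      have r0: "y (2 * n + 2) = l * y (2 * n + 1) - of_real (\<epsilon> n) * y (2 * n)"
        using y[of "2 * n"] by (simp add: b_even)
      have r1: "y (2 * n + 3) = l * y (2 * n + 2) - of_real (\<beta> n / \<epsilon> n) * y (2 * n + 1)"
        using y[of "2 * n + 1"] b_odd[of n] by (simp add: numeral_eq_Suc)
      have r2: "y (2 * n + 4) = l * y (2 * n + 3) + of_real (\<beta> n / \<epsilon> n) * y (2 * n + 2)"
        using y[of "2 * n + 2"] b_even[of "Suc n"] by (simp add: \<epsilon>_Suc numeral_eq_Suc)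
      have p: "complex_of_real (\<beta> n / \<epsilon> n) * of_real (\<epsilon> n) = of_real (\<beta> n)"
        using \<epsilon>[of n] \<sigma> by auto
      have "y (2 * n + 4) = l\<^sup>2 * y (2 * n + 2)
          + of_real (\<beta> n / \<epsilon> n) * (y (2 * n + 2) - l * y (2 * n + 1))"
        unfolding r2 r1 by (simp add: power2_eq_square algebra_simps)
      also have "y (2 * n + 2) - l * y (2 * n + 1) = - of_real (\<epsilon> n) * y (2 * n)"
        unfolding r0 by simp
      also have "l\<^sup>2 * y (2 * n + 2) + of_real (\<beta> n / \<epsilon> n) * (- of_real (\<epsilon> n) * y (2 * n))
          = l\<^sup>2 * y (2 * n + 2) - of_real (\<beta> n) * y (2 * n)"
        unfolding p[symmetric] by (simp add: mult.assoc)
      finally show ?thesis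
        by (simp add: numeral_eq_Suc)
    qed
    have even_bound: "cmod (y (2 * n)) \<le> D * A" for n
    proof -
      have "cmod (y (2 * n)) \<le> M * (cmod (y 0) + cmod (y 2))"
        using M[of "\<lambda>n. y (2 * n)" n] y2 by (simp add: solves_recurrence_def)
      also have "\<dots> \<le> C * (cmod (y 0) + cmod (y 2))"
        by (intro mult_right_mono) (auto simp: C_def)
      also have "\<dots> \<le> C * ((1 + cmod l + \<bar>\<sigma>\<bar>) * A)"
      proof (intro mult_left_mono)
        have "cmod (y 2) \<le> cmod (l * y 1) + cmod (of_real (b 0) * y 0)"
          using y[of 0] norm_triangle_ineq4[of "l * y 1" "of_real (b 0) * y 0"] by (simp add: numeral_eq_Suc)
        then have "cmod (y 2) \<le> cmod l * cmod (y 1) + \<bar>\<sigma>\<bar> * cmod (y 0)"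
          by (simp add: norm_mult b_abs)
        moreover have "0 \<le> cmod l * cmod (y 0)" "0 \<le> \<bar>\<sigma>\<bar> * cmod (y 1)" "0 \<le> cmod (y 1)"
          by auto
        moreover have "(1 + cmod l + \<bar>\<sigma>\<bar>) * A = cmod (y 0) + cmod (y 1) + cmod l * cmod (y 0)
            + cmod l * cmod (y 1) + \<bar>\<sigma>\<bar> * cmod (y 0) + \<bar>\<sigma>\<bar> * cmod (y 1)"
          by (simp add: A_def algebra_simps)
        ultimately show "cmod (y 0) + cmod (y 2) \<le> (1 + cmod l + \<bar>\<sigma>\<bar>) * A"
          by linarith
      qed (simp add: C_def)
      finally show ?thesis
        by (simp add: D_def mult_ac)
    qed
    have odd_bound: "cmod (y (2 * n + 1)) \<le> (1 + \<bar>\<sigma>\<bar>) * D / cmod l * A" for n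
    proof -
      have "l * y (2 * n + 1) = y (2 * (n + 1)) + of_real (b (2 * n)) * y (2 * n)"
        using y[of "2 * n"] by simp
      then have "cmod l * cmod (y (2 * n + 1)) = cmod (y (2 * (n + 1)) + of_real (b (2 * n)) * y (2 * n))"
        unfolding norm_mult[symmetric] by simp
      also have "\<dots> \<le> cmod (y (2 * (n + 1))) + \<bar>\<sigma>\<bar> * cmod (y (2 * n))"
        using norm_triangle_ineq[of "y (2 * (n + 1))" "of_real (b (2 * n)) * y (2 * n)"]
        by (simp add: norm_mult b_abs)
      also have "\<dots> \<le> D * A + \<bar>\<sigma>\<bar> * (D * A)"
        by (intro add_mono mult_left_mono even_bound) auto
      finally show ?thesis
        using l by (simp add: field_simps)
    qed
    have nonneg: "0 \<le> D * A" "0 \<le> (1 + \<bar>\<sigma>\<bar>) * D / cmod l * A"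
      using D A by auto
    have "cmod (y k) \<le> D * A + (1 + \<bar>\<sigma>\<bar>) * D / cmod l * A"
    proof (cases "even k")
      case True
      then obtain n where "k = 2 * n" by (rule evenE)
      then show ?thesis
        using even_bound[of n] nonneg by simp
    next
      case False
      then obtain n where "k = 2 * n + 1" by (rule oddE)
      then show ?thesis
        using odd_bound[of n] nonneg by simp
    qed
    then show ?thesis
      by (simp add: A_def algebra_simps)
  qed
  moreover have "range b \<subseteq> {\<sigma>, -\<sigma>}"
    using b by auto
  ultimately show ?thesis
    by (intro bounded_recurrenceI)
qed

lemma bounded_recurrence_dyadic_root:
  assumes "\<sigma> \<noteq> 0" "l \<noteq> 0" "bounded_recurrence (\<sigma> ^ (2 ^ k)) (l ^ (2 ^ k))"
  shows "bounded_recurrence \<sigma> l"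
  using assms(3)
proof (induction k)
  case (Suc k)
  then have "bounded_recurrence ((\<sigma> ^ 2 ^ k)\<^sup>2) ((l ^ 2 ^ k)\<^sup>2)"
    by (simp add: power_mult[symmetric] mult.commute)
  then have "bounded_recurrence (\<sigma> ^ 2 ^ k) (l ^ 2 ^ k)"
    using assms(1,2) by (intro bounded_recurrence_square_root[of "\<sigma> ^ 2 ^ k" "l ^ 2 ^ k"]) simp_all
  then show ?case
    by (rule Suc.IH)
qed simp

lemma bounded_recurrence_small:
  assumes \<sigma>: "0 \<le> \<sigma>" and small: "cmod l + \<sigma> \<le> 1"
  shows "bounded_recurrence \<sigma> l"
proof -
  have "cmod (y k) \<le> 1 * (cmod (y 0) + cmod (y 1))"
    if solves: "solves_recurrence (\<lambda>_. \<sigma>) l y" for y k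
  proof -
    have y: "y (k + 2) = l * y (k + 1) - of_real (\<sigma>) * y k" for k
      using solves by (simp add: solves_recurrence_def)
    define A where "A = cmod (y 0) + cmod (y 1)"
    have A: "0 \<le> A"
      by (simp add: A_def)
    have "cmod (y k) \<le> A \<and> cmod (y (k + 1)) \<le> A"
    proof (induction k)
      case (Suc k)
      have "cmod (y (k + 2)) \<le> cmod (l * y (k + 1)) + cmod (of_real \<sigma> * y k)"
        unfolding y by (rule norm_triangle_ineq4)
      also have "\<dots> \<le> cmod l * A + \<sigma> * A"
        using Suc \<sigma> by (auto simp: norm_mult intro!: add_mono mult_left_mono)
      also have "\<dots> \<le> 1 * A"
        unfolding distrib_right[symmetric] using small A by (intro mult_right_mono)
      finally show ?case
        using Suc by simp
    qed (simp add: A_def)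
    then show ?thesis
      by (simp add: A_def)
  qed
  then show ?thesis
    by (intro bounded_recurrenceI[of "\<lambda>_. \<sigma>" _ _ 1]) auto
qed

text \<open>For weights \<open>1\<close> and real \<open>r\<close> the form \<open>\<bar>v\<bar>\<^sup>2 + \<bar>u\<bar>\<^sup>2 - r Re (v u\<^sup>*)\<close> of two consecutive values
  \<open>u, v\<close> is conserved; for \<open>\<bar>r\<bar> < 2\<close> it is positive definite.\<close>

lemma bounded_recurrence_real:
  assumes r: "\<bar>r\<bar> < 2"
  shows "bounded_recurrence 1 (of_real r)"
proof -
  define \<delta> where "\<delta> = 1 - \<bar>r\<bar> / 2"
  have \<delta>: "0 < \<delta>"
    using r by (simp add: \<delta>_def)
  have "cmod (y k) \<le> sqrt (2 / \<delta>) * (cmod (y 0) + cmod (y 1))"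
    if solves: "solves_recurrence (\<lambda>_. 1) (of_real r) y" for y k
  proof -
    have y: "y (k + 2) = of_real r * y (k + 1) - y k" for k
      using solves by (simp add: solves_recurrence_def)
    define Q where "Q k = (cmod (y (k + 1)))\<^sup>2 + (cmod (y k))\<^sup>2 - r * Re (y (k + 1) * cnj (y k))" for k
    have step: "(cmod (of_real r * v - u))\<^sup>2 + (cmod v)\<^sup>2 - r * Re ((of_real r * v - u) * cnj v)
        = (cmod v)\<^sup>2 + (cmod u)\<^sup>2 - r * Re (v * cnj u)" for u v :: complex
      unfolding cmod_power2 by (simp add: power2_eq_square algebra_simps)
    have Q: "Q k = Q 0" for k
    proof (induction k)
      case (Suc k)
      have "y (Suc k + 1) = of_real r * y (k + 1) - y k"
        using y[of k] by simp
      then have "Q (Suc k) = Q k"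
        unfolding Q_def using step[of "y (k + 1)" "y k"] by simp
      with Suc show ?case by simp
    qed simp
    have cross: "\<bar>r * Re (v * cnj u)\<bar> \<le> \<bar>r\<bar> / 2 * ((cmod v)\<^sup>2 + (cmod u)\<^sup>2)" for u v
    proof -
      have "\<bar>Re (v * cnj u)\<bar> \<le> cmod v * cmod u"
        using abs_Re_le_cmod[of "v * cnj u"] by (simp add: norm_mult)
      also have "\<dots> \<le> ((cmod v)\<^sup>2 + (cmod u)\<^sup>2) / 2"
        using sum_squares_bound[of "cmod v" "cmod u"] by simp
      finally have "\<bar>r\<bar> * \<bar>Re (v * cnj u)\<bar> \<le> \<bar>r\<bar> * (((cmod v)\<^sup>2 + (cmod u)\<^sup>2) / 2)"
        by (intro mult_left_mono) auto
      then show ?thesis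
        by (simp add: abs_mult del: times_complex.sel)
    qed
    have "\<delta> * ((cmod (y (k + 1)))\<^sup>2 + (cmod (y k))\<^sup>2) \<le> Q k"
      unfolding Q_def \<delta>_def using cross[of "y (k + 1)" "y k"] by (simp add: algebra_simps abs_le_iff)
    also have "Q k \<le> (1 + \<bar>r\<bar> / 2) * ((cmod (y 1))\<^sup>2 + (cmod (y 0))\<^sup>2)"
      unfolding Q[of k] unfolding Q_def using cross[of "y 1" "y 0"]
      by (simp add: algebra_simps abs_le_iff)
    also have "\<dots> \<le> 2 * (cmod (y 0) + cmod (y 1))\<^sup>2"
      using r by (intro mult_mono) (auto simp: power2_sum)
    finally have "\<delta> * (cmod (y k))\<^sup>2 \<le> 2 * (cmod (y 0) + cmod (y 1))\<^sup>2"
      using \<delta> by (smt (verit) mult_left_mono zero_le_power2)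
    then have "(cmod (y k))\<^sup>2 \<le> 2 / \<delta> * (cmod (y 0) + cmod (y 1))\<^sup>2"
      using \<delta> by (simp add: field_simps)
    also have "\<dots> = (sqrt (2 / \<delta>) * (cmod (y 0) + cmod (y 1)))\<^sup>2"
      using \<delta> by (simp add: power_mult_distrib)
    finally show ?thesis
      by (rule power2_le_imp_le) (use \<delta> in simp)
  qed
  then show ?thesis
    by (intro bounded_recurrenceI[of "\<lambda>_. 1" _ _ "sqrt (2 / \<delta>)"]) auto
qed

section \<open>The unit disc\<close>

lemma ell2_norm_le_sqrt_card:
  assumes F: "finite F" and supp: "\<And>i. f i \<noteq> 0 \<Longrightarrow> i \<in> F" and B: "\<And>i. i \<in> F \<Longrightarrow> cmod (f i) \<le> B"
    and "0 \<le> B"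
  shows "ell2_norm f \<le> sqrt (card F) * B"
proof (rule ell2_if_finite_sections_bounded)
  fix G :: "'a set" assume G: "finite G"
  have "(\<Sum>i\<in>G. (cmod (f i))\<^sup>2) = (\<Sum>i\<in>G \<inter> F. (cmod (f i))\<^sup>2)"
    using G supp by (intro sum.mono_neutral_right) auto
  also have "\<dots> \<le> (\<Sum>i\<in>F. (cmod (f i))\<^sup>2)"
    using F by (intro sum_mono2) auto
  also have "\<dots> \<le> (\<Sum>i\<in>F. B\<^sup>2)"
    using B by (intro sum_mono power_mono) auto
  finally have "(L2_set (\<lambda>i. cmod (f i)) G)\<^sup>2 \<le> (sqrt (card F) * B)\<^sup>2"
    by (simp add: L2_set_power2 power_mult_distrib)
  then show "L2_set (\<lambda>i. cmod (f i)) G \<le> sqrt (card F) * B"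
    by (rule power2_le_imp_le) (use \<open>0 \<le> B\<close> in simp)
qed

text \<open>With \<open>\<psi>\<close> the solution from the left end and \<open>\<eta>\<close> decreasing linearly from \<open>1\<close> to \<open>0\<close> along a copy
  of length \<open>K\<close> of the word, the error of \<open>\<eta> \<psi>\<close> lives on that copy. Its entries are at most of order
  \<open>a / K\<close>, where \<open>a\<close> is the size of \<open>\<psi>\<close> at the beginning of the copy, so its norm is of order
  \<open>a / sqrt K\<close>, whereas the norm of \<open>\<eta> \<psi>\<close> is at least \<open>a / 2\<close>.\<close>

lemma bounded_recurrence_imp_approx_spectrum:
  assumes \<sigma>: "0 < \<sigma>" "\<sigma> \<le> 1" and c: "range c \<subseteq> {\<sigma>, -\<sigma>}" and pe: "pseudo_ergodic \<sigma> c"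
    and bounded: "bounded_recurrence \<sigma> l"
  shows "l \<in> approx_spectrum (A_plus c)"
  unfolding approx_spectrum_def mem_Collect_eq
proof (intro allI impI)
  fix e :: real assume e: "0 < e"
  have c_cases: "c n = \<sigma> \<or> c n = -\<sigma>" for n
    using c by auto
  have c_abs: "\<bar>c n\<bar> \<le> 1" and c_nz: "c n \<noteq> 0" for n
    using c_cases[of n] \<sigma> by auto
  obtain \<beta> M0 where \<beta>: "range \<beta> \<subseteq> {\<sigma>, -\<sigma>}"
    and M0: "\<And>y k. solves_recurrence \<beta> l y \<Longrightarrow> cmod (y k) \<le> M0 * (cmod (y 0) + cmod (y 1))"
    using bounded unfolding bounded_recurrence_def by blast
  define M where "M = max M0 1"
  have M: "0 < M"
    by (simp add: M_def)
  obtain K :: nat where "(4 * M / e)\<^sup>2 < real K"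
    using reals_Archimedean2 by blast
  moreover have "0 < (4 * M / e)\<^sup>2"
    using M e by auto
  ultimately have K: "(4 * M / e)\<^sup>2 < real K" "0 < real K" "0 < K"
    by (auto intro: Nat.gr0I)
  obtain m :: nat where m: "\<And>k. k < K \<Longrightarrow> c (m + k) = \<beta> k"
  proof -
    let ?w = "map \<beta> [0..<K]"
    have "set ?w \<subseteq> {\<sigma>, -\<sigma>}"
      using \<beta> by auto
    then obtain n where "\<forall>k<length ?w. c (n + of_nat k) = ?w ! k"
      using pe unfolding pseudo_ergodic_def by blast
    then show thesis
      using that[of n] by auto
  qed
  \<comment> \<open>The initial values make \<open>\<psi>\<close> satisfy row \<open>0\<close> of the eigenvalue equation.\<close>
  define \<psi> where "\<psi> = recurrence c l 1 l"
  have \<psi>_rec: "\<psi> (k + 2) = l * \<psi> (k + 1) - of_real (c k) * \<psi> k" for k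
    using solves_recurrence_recurrence unfolding \<psi>_def solves_recurrence_def by blast
  have \<psi>_eigen: "A_plus c \<psi> j = l * \<psi> j" for j
  proof (cases j)
    case 0
    then show ?thesis by (simp add: A_plus_apply \<psi>_def)
  next
    case (Suc k)
    then show ?thesis using \<psi>_rec[of k] by (simp add: A_plus_apply)
  qed
  define a where "a = cmod (\<psi> m) + cmod (\<psi> (m + 1))"
  have \<psi>_nz: "\<psi> k \<noteq> 0 \<or> \<psi> (k + 1) \<noteq> 0" for k
  proof (induction k)
    case (Suc k)
    then show ?case
      using \<psi>_rec[of k] c_nz[of k] by auto
  qed (simp add: \<psi>_def)
  have a: "0 < a"
    using \<psi>_nz[of m] unfolding a_def by (auto intro: add_pos_nonneg add_nonneg_pos)
  have \<psi>_block: "cmod (\<psi> (m + k)) \<le> M * a" if "k \<le> K + 1" for k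
  proof -
    define y where "y = recurrence \<beta> l (\<psi> m) (\<psi> (m + 1))"
    have y: "solves_recurrence \<beta> l y"
      unfolding y_def by (rule solves_recurrence_recurrence)
    then have y_rec: "y (k + 2) = l * y (k + 1) - of_real (\<beta> k) * y k" for k
      by (simp add: solves_recurrence_def)
    have "cmod (y k) \<le> M0 * a"
      using M0[OF y, of k] by (simp add: y_def a_def)
    also have "\<dots> \<le> M * a"
      using a by (intro mult_right_mono) (auto simp: M_def)
    finally have "cmod (y k) \<le> M * a" .
    moreover have "k \<le> K \<Longrightarrow> y k = \<psi> (m + k) \<and> y (k + 1) = \<psi> (m + k + 1)" for k
    proof (induction k)
      case (Suc k)
      then show ?case
        using y_rec[of k] \<psi>_rec[of "m + k"] m[of k] by simp
    qed (simp add: y_def)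
    from this[of k] this[of "k - 1"] that have "y k = \<psi> (m + k)"
      by (cases "k \<le> K") auto
    ultimately show ?thesis by simp
  qed
  define \<eta> where "\<eta> j = max 0 (min 1 ((real (m + 1 + K) - real j) / real K))" for j
  define x where "x j = of_real (\<eta> j) * \<psi> j" for j
  have \<eta>_one: "\<eta> j = 1" if "j \<le> m + 1" for j
    using that K by (simp add: \<eta>_def field_simps)
  have \<eta>_zero: "\<eta> j = 0" if "m + 1 + K \<le> j" for j
  proof -
    have "(real (m + 1 + K) - real j) / real K \<le> 0"
      using that by (intro divide_nonpos_nonneg) auto
    then show ?thesis
      unfolding \<eta>_def by linarith
  qed
  have \<eta>_step: "\<bar>\<eta> (j + 1) - \<eta> j\<bar> \<le> 1 / real K" for j
  proof -
    have clamp: "\<bar>max 0 (min 1 u) - max 0 (min 1 v)\<bar> \<le> \<bar>u - v\<bar>" for u v :: real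
      by linarith
    have "(real (m + 1 + K) - real (j + 1)) / real K - (real (m + 1 + K) - real j) / real K = - (1 / real K)"
      using K by (simp add: field_simps)
    then show ?thesis
      unfolding \<eta>_def by (intro order_trans[OF clamp]) simp
  qed
  have \<eta>_const: "\<eta> (j + 1) = \<eta> j" if "j \<notin> {m + 1..m + K}" for j
    using that \<eta>_one[of j] \<eta>_one[of "j + 1"] \<eta>_zero[of j] \<eta>_zero[of "j + 1"] by fastforce
  have fin: "finite {j. x j \<noteq> 0}"
  proof (rule finite_subset)
    show "{j. x j \<noteq> 0} \<subseteq> {..m + 1 + K}"
    proof
      fix j assume "j \<in> {j. x j \<noteq> 0}"
      then have "\<eta> j \<noteq> 0"
        by (simp add: x_def)
      then show "j \<in> {..m + 1 + K}"
        using \<eta>_zero[of j] by fastforce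
    qed
  qed simp
  have x: "x \<in> ell2"
    using fin by (rule ell2_finite_support)
  define r1 where "r1 j = (if j = 0 then 0 else of_real (c (j - 1)) * (of_real (\<eta> (j - 1) - \<eta> j) * \<psi> (j - 1)))" for j
  define r2 where "r2 j = of_real (\<eta> (j + 1) - \<eta> j) * \<psi> (j + 1)" for j
  have res: "A_plus c x j - l * x j = r1 j + r2 j" for j
  proof -
    have "A_plus c x j - of_real (\<eta> j) * A_plus c \<psi> j = r1 j + r2 j"
      by (simp add: A_plus_apply x_def r1_def r2_def algebra_simps)
    then show ?thesis
      by (simp add: \<psi>_eigen x_def mult_ac)
  qed
  have bound: "cmod (of_real t * \<psi> i) \<le> M * a / real K"
    if "\<bar>t\<bar> \<le> 1 / real K" "i \<in> {m..m + K + 1}" for t i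
  proof -
    have "cmod (\<psi> i) \<le> M * a"
    proof -
      have "i - m \<le> K + 1" "m + (i - m) = i"
        using that(2) by auto
      with \<psi>_block[of "i - m"] show ?thesis by simp
    qed
    with that(1) have "\<bar>t\<bar> * cmod (\<psi> i) \<le> 1 / real K * (M * a)"
      using M a by (intro mult_mono) auto
    then show ?thesis
      by (simp add: norm_mult)
  qed
  have Ma: "0 \<le> M * a / real K"
    using M a by simp
  have r1_supp: "j \<in> {m + 2..m + K + 1}" if "r1 j \<noteq> 0" for j
  proof -
    have "j \<noteq> 0" "\<eta> (j - 1 + 1) \<noteq> \<eta> (j - 1)"
      using that by (auto simp: r1_def split: if_splits)
    then show ?thesis
      using \<eta>_const[of "j - 1"] by fastforce
  qed
  have r2_supp: "j \<in> {m + 1..m + K}" if "r2 j \<noteq> 0" for j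
    using that \<eta>_const[of j] by (fastforce simp: r2_def)
  have r1: "ell2_norm r1 \<le> sqrt (card {m + 2..m + K + 1}) * (M * a / real K)"
  proof (rule ell2_norm_le_sqrt_card[OF _ r1_supp])
    fix j assume j: "j \<in> {m + 2..m + K + 1}"
    have "cmod (of_real (\<eta> (j - 1) - \<eta> j) * \<psi> (j - 1)) \<le> M * a / real K"
      using \<eta>_step[of "j - 1"] j by (intro bound) (auto simp: abs_minus_commute)
    then have "\<bar>c (j - 1)\<bar> * cmod (of_real (\<eta> (j - 1) - \<eta> j) * \<psi> (j - 1)) \<le> 1 * (M * a / real K)"
      using c_abs by (intro mult_mono) auto
    then show "cmod (r1 j) \<le> M * a / real K"
      using j by (simp add: r1_def norm_mult)
  qed (use Ma in auto)
  have r2: "ell2_norm r2 \<le> sqrt (card {m + 1..m + K}) * (M * a / real K)"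
  proof (rule ell2_norm_le_sqrt_card[OF _ r2_supp])
    fix j assume "j \<in> {m + 1..m + K}"
    then show "cmod (r2 j) \<le> M * a / real K"
      unfolding r2_def using \<eta>_step[of j] by (intro bound) auto
  qed (use Ma in auto)
  have "finite {j. r1 j \<noteq> 0}" "finite {j. r2 j \<noteq> 0}"
    using r1_supp r2_supp by (auto intro: finite_subset[of _ "{m + 2..m + K + 1}"]
        finite_subset[of _ "{m + 1..m + K}"])
  then have "ell2_norm (\<lambda>j. r1 j + r2 j) \<le> ell2_norm r1 + ell2_norm r2"
    by (intro ell2_norm_triangle ell2_finite_support)
  also have "\<dots> \<le> sqrt (real K) * (M * a / real K) + sqrt (real K) * (M * a / real K)"
    using add_mono[OF r1 r2] by simp
  also have "\<dots> = 2 * M * a / sqrt (real K)"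
    using K by (simp add: field_simps)
  also have "\<dots> < e * (a / 2)"
  proof -
    have "4 * M / e < sqrt (real K)"
      using K(1) M e by (intro real_less_rsqrt) auto
    then show ?thesis
      using a e K M by (simp add: field_simps)
  qed
  also have "\<dots> \<le> e * ell2_norm x"
  proof (intro mult_left_mono)
    have "\<eta> m = 1" "\<eta> (m + 1) = 1"
      by (simp_all add: \<eta>_one)
    then show "a / 2 \<le> ell2_norm x"
      using cmod_le_ell2_norm[OF x, of m] cmod_le_ell2_norm[OF x, of "m + 1"]
      by (simp add: a_def x_def)
  qed (use e in simp)
  finally have "ell2_norm (\<lambda>j. A_plus c x j - l * x j) < e * ell2_norm x"
    by (simp add: res)
  with fin show "\<exists>f. finite {i. f i \<noteq> 0} \<and> ell2_norm (\<lambda>i. A_plus c f i - l * f i) < e * ell2_norm f"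
    by blast
qed

lemma cmod_cis_diff: "cmod (cis s - cis t) \<le> \<bar>s - t\<bar>"
proof -
  have "cis s - cis t = cis t * (cis (s - t) - 1)"
    by (simp add: algebra_simps cis_mult)
  then have "cmod (cis s - cis t) = 2 * \<bar>sin ((s - t) / 2)\<bar>"
    using dist_exp_i_1[of "s - t"] by (simp add: norm_mult cis_conv_exp)
  also have "\<dots> \<le> \<bar>s - t\<bar>"
    using abs_sin_x_le_abs_x[of "(s - t) / 2"] by simp
  finally show ?thesis .
qed

text \<open>The modulus is moved slightly towards \<open>1/2\<close>, so that it becomes neither \<open>0\<close> nor \<open>1\<close>.\<close>

lemma dyadic_angles_dense:
  assumes l: "cmod l \<le> 1" and e: "0 < e"
  obtains r and j :: int and k :: nat where "0 < r" "r < 1"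
    "cmod (of_real r * cis (2 * pi * j / 2 ^ k) - l) < e"
proof -
  define \<delta> where "\<delta> = min (1/2) (e / 4)"
  define r where "r = (1 - \<delta>) * cmod l + \<delta> / 2"
  have \<delta>: "0 < \<delta>" "\<delta> \<le> 1/2" "\<delta> \<le> e / 4"
    using e by (auto simp: \<delta>_def)
  have "(1 - \<delta>) * cmod l \<le> 1 - \<delta>"
    using mult_left_mono[OF l, of "1 - \<delta>"] \<delta> by simp
  moreover have "0 \<le> (1 - \<delta>) * cmod l"
    using \<delta> by simp
  ultimately have r: "0 < r" "r < 1"
    using \<delta>(1) unfolding r_def by linarith+
  have "r - cmod l = \<delta> * (1/2 - cmod l)"
    by (simp add: r_def algebra_simps)
  then have "\<bar>r - cmod l\<bar> = \<delta> * \<bar>1/2 - cmod l\<bar>"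
    using \<delta> by (simp add: abs_mult)
  also have "\<dots> \<le> \<delta> * 1"
    using l norm_ge_zero[of l] \<delta>(1) by (intro mult_left_mono; linarith)
  finally have r_close: "\<bar>r - cmod l\<bar> < e / 2"
    using \<delta> e by simp
  define \<theta> where "\<theta> = Arg l"
  obtain k :: nat where k: "2 * pi / (e / 2) < 2 ^ k"
    using real_arch_pow[of 2 "2 * pi / (e / 2)"] by auto
  define j where "j = \<lfloor>\<theta> * 2 ^ k / (2 * pi)\<rfloor>"
  have "\<bar>2 * pi * j / 2 ^ k - \<theta>\<bar> \<le> 2 * pi / 2 ^ k"
  proof -
    have "\<bar>of_int j - \<theta> * 2 ^ k / (2 * pi)\<bar> \<le> 1"
      unfolding j_def by linarith
    then have "2 * pi / 2 ^ k * \<bar>of_int j - \<theta> * 2 ^ k / (2 * pi)\<bar> \<le> 2 * pi / 2 ^ k * 1"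
      by (intro mult_left_mono) auto
    also have "2 * pi / 2 ^ k * \<bar>of_int j - \<theta> * 2 ^ k / (2 * pi)\<bar>
        = \<bar>2 * pi / 2 ^ k * (of_int j - \<theta> * 2 ^ k / (2 * pi))\<bar>"
      by (simp add: abs_mult)
    also have "2 * pi / 2 ^ k * (of_int j - \<theta> * 2 ^ k / (2 * pi)) = 2 * pi * j / 2 ^ k - \<theta>"
      by (simp add: field_simps)
    finally show ?thesis by simp
  qed
  also have "2 * pi / 2 ^ k < e / 2"
    using k e by (simp add: field_simps)
  finally have angle: "cmod (cis (2 * pi * j / 2 ^ k) - cis \<theta>) < e / 2"
    using cmod_cis_diff[of "2 * pi * j / 2 ^ k" \<theta>] by linarith
  have l_polar: "l = of_real (cmod l) * cis \<theta>"
    using rcis_cmod_Arg[of l] by (simp add: rcis_def \<theta>_def)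
  have "of_real r * cis (2 * pi * j / 2 ^ k) - l
      = of_real r * (cis (2 * pi * j / 2 ^ k) - cis \<theta>) + of_real (r - cmod l) * cis \<theta>"
    by (subst l_polar) (simp add: algebra_simps)
  also have "cmod \<dots> \<le> r * cmod (cis (2 * pi * j / 2 ^ k) - cis \<theta>) + \<bar>r - cmod l\<bar>"
    using norm_triangle_ineq[of "of_real r * (cis (2 * pi * j / 2 ^ k) - cis \<theta>)"
        "of_real (r - cmod l) * cis \<theta>"] r by (simp add: norm_mult del: of_real_diff)
  also have "\<dots> \<le> 1 * cmod (cis (2 * pi * j / 2 ^ k) - cis \<theta>) + \<bar>r - cmod l\<bar>"
    using r by (intro add_right_mono mult_right_mono) auto
  also have "\<dots> < e"
    using angle r_close by simp
  finally show thesis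
    using that r by blast
qed

text \<open>For \<open>\<sigma> = 1\<close> exactly \<open>k\<close> squarings make the number real. For \<open>\<sigma> < 1\<close> the angle is irrelevant, and
  the squarings are repeated until modulus and weight are both small.\<close>

lemma bounded_recurrence_dyadic_angle:
  assumes \<sigma>: "0 < \<sigma>" "\<sigma> \<le> 1" and r: "0 < r" "r < 1"
  shows "bounded_recurrence \<sigma> (of_real r * cis (2 * pi * of_int j / 2 ^ k))"
    (is "bounded_recurrence \<sigma> ?l")
proof (cases "\<sigma> = 1")
  case True
  have "?l ^ (2 ^ k) = of_real (r ^ 2 ^ k) * cis (2 * pi * of_int j)"
    by (simp add: power_mult_distrib Complex.DeMoivre)
  also have "cis (2 * pi * of_int j) = 1"
    by simp
  finally have "bounded_recurrence (\<sigma> ^ 2 ^ k) (?l ^ 2 ^ k)"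
    using bounded_recurrence_real[of "r ^ 2 ^ k"] True r power_le_one[of r "2 ^ k"] by simp
  then show ?thesis
    using \<sigma> r by (intro bounded_recurrence_dyadic_root[of \<sigma> ?l k]) auto
next
  case False
  have "(\<lambda>n. r ^ n + \<sigma> ^ n) \<longlonglongrightarrow> 0 + 0"
    using \<sigma> r False by (intro tendsto_add LIMSEQ_realpow_zero) auto
  then have "eventually (\<lambda>n. r ^ n + \<sigma> ^ n < 1) sequentially"
    by (rule order_tendstoD) simp
  then obtain n where n: "\<And>i. n \<le> i \<Longrightarrow> r ^ i + \<sigma> ^ i < 1"
    by (auto simp: eventually_sequentially)
  have "bounded_recurrence (\<sigma> ^ 2 ^ n) (?l ^ 2 ^ n)"
    using n[of "2 ^ n"] less_exp[of n] \<sigma> r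
    by (intro bounded_recurrence_small) (auto simp: norm_mult norm_power)
  then show ?thesis
    using \<sigma> r by (intro bounded_recurrence_dyadic_root[of \<sigma> ?l n]) auto
qed

theorem theorem35:
  fixes \<sigma> :: real and c :: "nat \<Rightarrow> real"
  assumes "0 < \<sigma>" and "\<sigma> \<le> 1"
    and "range c \<subseteq> {\<sigma>, -\<sigma>}"
    and "pseudo_ergodic \<sigma> c"
  shows "(\<sigma> = 1 \<longrightarrow> Spec (A_plus c) = S) \<and> {l. cmod l \<le> 1} \<subseteq> Spec (A_plus c)"
proof (intro conjI impI subsetI)
  assume "\<sigma> = 1"
  with assms show "Spec (A_plus c) = S"
    using Spec_A_plus_pseudo_ergodic[of c] S_eq_sign_hopping_approx_spectrum[of c] by simp
next
  have "\<bar>c n\<bar> \<le> 1" for n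
    using assms(1-3) by (smt (verit) insert_iff range_subsetD singletonD)
  then interpret ell2_operator "A_plus c" 2
    by (rule ell2_operator_A_plus)
  fix l assume "l \<in> {l. cmod l \<le> 1}"
  then have l: "cmod l \<le> 1" by simp
  have "l \<in> approx_spectrum (A_plus c)"
  proof (rule approx_spectrum_closed)
    fix e :: real assume "0 < e"
    then obtain r j k where r: "0 < r" "r < 1"
      and close: "cmod (of_real r * cis (2 * pi * of_int j / 2 ^ k) - l) < e"
      using dyadic_angles_dense[OF l] by blast
    have "of_real r * cis (2 * pi * of_int j / 2 ^ k) \<in> approx_spectrum (A_plus c)"
      by (intro bounded_recurrence_imp_approx_spectrum[OF assms] bounded_recurrence_dyadic_angle
          assms(1,2) r)
    with close show "\<exists>m\<in>approx_spectrum (A_plus c). cmod (m - l) < e"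
      by blast
  qed
  then show "l \<in> Spec (A_plus c)"
    using approx_spectrum_subset_Spec by blast
qed

end
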